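(* For $M\ge 1$, let $P_0,P_1,\dots,P_M$ be probability measures defined on the same measurable space, and let $X$ be a random variable. (i) Set $\Delta:=(E_{P_1}[X]-E_{P_0}[X],\dots,E_{P_M}[X]-E_{P_0}[X])^\top$. If $P_j\ll P_0$ for all $j=1,\dots,M$, then $$\Delta^\top\,\chi^2(P_0,\dots,P_M)^+\,\Delta\leq \mathrm{Var}_{P_0}(X),$$ where $\chi^2(P_0,\dots,P_M)^+$ denotes the Moore-Penrose inverse of the $\chi^2$-divergence matrix. (ii) Let $A_\ell:=\rho(P_\ell\,|\,P_1,\dots,P_{\ell-1},P_{\ell+1},\dots,P_M)$. Then, for $M\geq 2$, $$2M\sum_{j=1}^M\Big(E_{P_j}[X]-\frac1M\sum_{\ell=1}^M E_{P_\ell}[X]\Big)^2=\sum_{j,k=1}^M\big(E_{P_j}[X]-E_{P_k}[X]\big)^2\leq 4\max_{\ell=1,\dots,M}\lambda_1(A_\ell)\sum_{k=1}^M\mathrm{Var}_{P_k}(X),$$ where $\lambda_1(A_\ell)$ denotes the largest eigenvalue (spectral norm) of the positive semi-definite Hellinger affinity matrix $A_\ell$.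
   Context: $E_P,\mathrm{Var}_P$ denote expectation and variance under $P$; if $X$ is not square integrable under $P$, then $\mathrm{Var}_P(X):=+\infty$. $\nu$ is a measure dominating all the measures considered, and $p_j$ denotes the $\nu$-density of $P_j$. If $P_0$ dominates $P_1,\dots,P_M$, the $\chi^2$-divergence matrix $\chi^2(P_0,\dots,P_M)$ is the $M\times M$ matrix with $(j,k)$-th entry $\chi^2(P_0,\dots,P_M)_{j,k}:=\int\frac{dP_j}{dP_0}\,dP_k-1$. For probability measures $Q_0,Q_1,\dots,Q_L$ with $\nu$-densities $q_0,\dots,q_L$, the Hellinger affinity matrix $\rho(Q_0\,|\,Q_1,\dots,Q_L)$ is the $L\times L$ matrix with entries $$\rho(Q_0|Q_1,\dots,Q_L)_{j,k}:=\frac{\int\sqrt{q_jq_k}\,d\nu}{\int\sqrt{q_jq_0}\,d\nu\int\sqrt{q_kq_0}\,d\nu}-1,\qquad j,k=1,\dots,L.$$ Whenever such a matrix is used, it is implicitly assumed that the measures are chosen such that the Hellinger affinities $\int\sqrt{q_jq_0}\,d\nu$ are positive, so that the matrix is well-defined. *)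

theory Defs
  imports "HOL-Probability.Probability" "Jordan_Normal_Form.Spectral_Radius"
begin

definition ext_variance :: "'a measure \<Rightarrow> ('a \<Rightarrow> real) \<Rightarrow> ereal" where
  "ext_variance P X =
     (if integrable P (\<lambda>x. (X x)^2) then ereal (prob_space.variance P X) else \<infinity>)"

text \<open>The value \<^term>\<open>\<integral>\<^sup>+ x. RN_deriv P\<^sub>0 Q x \<partial>R\<close> of the integral of $dQ/dP_0$ against $R$ may be
  infinite.\<close>

definition chi2_integral :: "'a measure \<Rightarrow> 'a measure \<Rightarrow> 'a measure \<Rightarrow> ennreal" where
  "chi2_integral P\<^sub>0 Q R = (\<integral>\<^sup>+ x. RN_deriv P\<^sub>0 Q x \<partial>R)"

text \<open>The list \<open>Ps\<close> holds $P_1, \dots, P_M$, so the entry with 0-based index $(i,k)$ belongs to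
  $P_{i+1}$ and $P_{k+1}$. This is a real matrix, and it is the $\chi^2$-divergence matrix only if
  all the integrals are finite, since \<^const>\<open>enn2real\<close> maps \<open>\<infinity>\<close> to 0.\<close>

definition chi2_matrix :: "'a measure \<Rightarrow> 'a measure list \<Rightarrow> real mat" where
  "chi2_matrix P\<^sub>0 Ps = mat (length Ps) (length Ps)
     (\<lambda>(i, k). enn2real (chi2_integral P\<^sub>0 (Ps ! i) (Ps ! k)) - 1)"

definition is_moore_penrose :: "real mat \<Rightarrow> real mat \<Rightarrow> bool" where
  "is_moore_penrose A B \<longleftrightarrow>
     B \<in> carrier_mat (dim_col A) (dim_row A) \<and>
     A * B * A = A \<and> B * A * B = B \<and>
     transpose_mat (A * B) = A * B \<and> transpose_mat (B * A) = B * A"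

definition moore_penrose :: "real mat \<Rightarrow> real mat" where
  "moore_penrose A = (THE B. is_moore_penrose A B)"

text \<open>\<open>p\<close> is a (real-valued) version of the \<open>\<nu>\<close>-density of \<open>P\<close>; \<open>\<nu>\<close> need not be
  \<open>\<sigma>\<close>-finite.\<close>

definition is_density :: "'a measure \<Rightarrow> 'a measure \<Rightarrow> ('a \<Rightarrow> real) \<Rightarrow> bool" where
  "is_density \<nu> P p \<longleftrightarrow>
     p \<in> borel_measurable \<nu> \<and> (\<forall>x\<in>space \<nu>. 0 \<le> p x) \<and> P = density \<nu> (\<lambda>x. ennreal (p x))"

definition hellinger_affinity :: "'a measure \<Rightarrow> ('a \<Rightarrow> real) \<Rightarrow> ('a \<Rightarrow> real) \<Rightarrow> real" where
  "hellinger_affinity \<nu> p q = (\<integral>x. sqrt (p x * q x) \<partial>\<nu>)"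

text \<open>The matrix $\rho(Q_0 \,|\, Q_1, \dots, Q_L)$ in terms of the \<open>\<nu>\<close>-densities: \<open>q\<^sub>0\<close> is the one of
  $Q_0$ and the list \<open>qs\<close> holds those of $Q_1, \dots, Q_L$.\<close>

definition hellinger_matrix ::
  "'a measure \<Rightarrow> ('a \<Rightarrow> real) \<Rightarrow> ('a \<Rightarrow> real) list \<Rightarrow> real mat" where
  "hellinger_matrix \<nu> q\<^sub>0 qs = mat (length qs) (length qs)
     (\<lambda>(i, k). hellinger_affinity \<nu> (qs ! i) (qs ! k) /
        (hellinger_affinity \<nu> (qs ! i) q\<^sub>0 * hellinger_affinity \<nu> (qs ! k) q\<^sub>0) - 1)"

text \<open>Only the real eigenvalues are considered; for symmetric matrices these are all of them.\<close>

definition largest_eigenvalue :: "real mat \<Rightarrow> real" where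
  "largest_eigenvalue A = Max (spectrum A)"

end

theory Submission
  imports Defs
begin

text \<open>Both bounds are instances of one Hilbert space estimate. For square integrable \<open>h\<close> and
  \<open>g\<^sub>1, \<dots>, g\<^sub>n\<close> with Gram matrix \<open>G\<close> put \<open>w\<^sub>i = \<langle>g\<^sub>i, h\<rangle>\<close>. Cauchy-Schwarz for
  \<open>\<langle>\<Sum> c\<^sub>i g\<^sub>i, h\<rangle>\<close> gives \<open>(c \<bullet> w)\<^sup>2 \<le> (c \<bullet> G c) \<parallel>h\<parallel>\<^sup>2\<close>; the choices
  \<open>c = G\<^sup>+ w\<close> and \<open>c = w\<close> yield \<open>w \<bullet> G\<^sup>+ w \<le> \<parallel>h\<parallel>\<^sup>2\<close> and
  \<open>w \<bullet> w \<le> \<lambda>\<^sub>1(G) \<parallel>h\<parallel>\<^sup>2\<close>.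

  Part (i) is the first bound in \<open>L\<^sup>2(P\<^sub>0)\<close> with \<open>g\<^sub>j = dP\<^sub>j/dP\<^sub>0 - 1\<close> and
  \<open>h = X - E\<^sub>0 X\<close>. For part (ii), the functions \<open>g\<^sub>j = \<surd>p\<^sub>j / \<rho>\<^sub>j\<^sub>l - \<surd>p\<^sub>l\<close> have the
  Hellinger affinity matrix \<open>A\<^sub>l\<close> as Gram matrix in \<open>L\<^sup>2(\<nu>)\<close>. With
  \<open>h = (X - E\<^sub>l X) \<surd>p\<^sub>l\<close> and \<open>w\<^sub>l\<^sub>j = \<langle>g\<^sub>j, h\<rangle>\<close> one has \<open>E\<^sub>j X - E\<^sub>l X = w\<^sub>l\<^sub>j - w\<^sub>j\<^sub>l\<close>,
  so that \<open>(a - b)\<^sup>2 \<le> 2 a\<^sup>2 + 2 b\<^sup>2\<close> and the second bound for each \<open>l\<close> give the claim.\<close>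

unbundle no inner_syntax and no vec_syntax

subsection \<open>Real symmetric matrices and their Moore-Penrose inverses\<close>

lemma scalar_prod_self_pos:
  fixes v :: "real vec"
  assumes "v \<in> carrier_vec n" "v \<noteq> 0\<^sub>v n"
  shows "v \<bullet> v > 0"
proof -
  obtain i where "i < n" "v $ i \<noteq> 0" using assms by (metis carrier_vecD eq_vecI index_zero_vec)
  then show ?thesis using assms
    unfolding scalar_prod_def by (intro sum_pos2[of _ i]) (auto simp: less_le)
qed

text \<open>The complexified matrix has an eigenvector z = a + i b with eigenvalue l. Symmetry gives
  (A a) \<bullet> b = a \<bullet> (A b), which expands to Im l (a \<bullet> a + b \<bullet> b) = 0.
  So l is real, and whichever of a and b is nonzero is a real eigenvector.\<close>

lemma symmetric_real_eigenvalue: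
  fixes A :: "real mat"
  assumes A: "A \<in> carrier_mat n n" and sym: "transpose_mat A = A" and n: "n > 0"
  obtains e v where "v \<in> carrier_vec n" "v \<noteq> 0\<^sub>v n" "A *\<^sub>v v = e \<cdot>\<^sub>v v"
proof -
  let ?C = "map_mat complex_of_real A"
  have C: "?C \<in> carrier_mat n n" using A by simp
  from spectrum_non_empty[OF C n] obtain l where "eigenvalue ?C l"
    by (auto simp: spectrum_def)
  then obtain z where z: "z \<in> carrier_vec n" "z \<noteq> 0\<^sub>v n" "?C *\<^sub>v z = l \<cdot>\<^sub>v z"
    using A unfolding eigenvalue_def eigenvector_def by auto
  define a b where "a = map_vec Re z" and "b = map_vec Im z"
  have ab: "a \<in> carrier_vec n" "b \<in> carrier_vec n" using z by (auto simp: a_def b_def)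
  have comp: "(\<Sum>k<n. complex_of_real (A $$ (i,k)) * z $ k) = l * z $ i" if i: "i < n" for i
  proof -
    have "(?C *\<^sub>v z) $ i = l * z $ i" using z i by simp
    then show ?thesis using A z(1) i
      by (simp add: scalar_prod_def lessThan_atLeast0 row_def)
  qed
  have Aa: "A *\<^sub>v a = Re l \<cdot>\<^sub>v a - Im l \<cdot>\<^sub>v b"
  proof (rule eq_vecI)
    fix i assume "i < dim_vec (Re l \<cdot>\<^sub>v a - Im l \<cdot>\<^sub>v b)"
    then have i: "i < n" using ab by simp
    have "(\<Sum>k<n. A $$ (i,k) * Re (z $ k)) = Re (l * z $ i)"
      by (subst comp[OF i, symmetric]) simp
    then show "(A *\<^sub>v a) $ i = (Re l \<cdot>\<^sub>v a - Im l \<cdot>\<^sub>v b) $ i"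
      using A z(1) i ab
      by (simp add: scalar_prod_def lessThan_atLeast0 row_def a_def b_def)
  qed (use A ab in auto)
  have Ab: "A *\<^sub>v b = Im l \<cdot>\<^sub>v a + Re l \<cdot>\<^sub>v b"
  proof (rule eq_vecI)
    fix i assume "i < dim_vec (Im l \<cdot>\<^sub>v a + Re l \<cdot>\<^sub>v b)"
    then have i: "i < n" using ab by simp
    have "(\<Sum>k<n. A $$ (i,k) * Im (z $ k)) = Im (l * z $ i)"
      by (subst comp[OF i, symmetric]) simp
    then show "(A *\<^sub>v b) $ i = (Im l \<cdot>\<^sub>v a + Re l \<cdot>\<^sub>v b) $ i"
      using A z(1) i ab
      by (simp add: scalar_prod_def lessThan_atLeast0 row_def a_def b_def)
  qed (use A ab in auto)
  have ne: "a \<noteq> 0\<^sub>v n \<or> b \<noteq> 0\<^sub>v n"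
  proof (rule ccontr)
    assume "\<not> ?thesis"
    then have "a $ i = 0 \<and> b $ i = 0" if "i < n" for i using that by simp
    then have "z = 0\<^sub>v n"
      using z(1) by (intro eq_vecI) (auto simp: a_def b_def complex_eq_iff)
    with z show False by simp
  qed
  have "(A *\<^sub>v a) \<bullet> b = a \<bullet> (A *\<^sub>v b)"
    using transpose_vec_mult_scalar[OF A ab(2) ab(1)] sym
      comm_scalar_prod[OF mult_mat_vec_carrier[OF A ab(2)] ab(1)]
      comm_scalar_prod[OF ab(2) mult_mat_vec_carrier[OF A ab(1)]] by simp
  then have "Im l * (a \<bullet> a + b \<bullet> b) = 0"
    using ab comm_scalar_prod[OF ab] unfolding Aa Ab
    by (simp add: minus_scalar_prod_distrib[of _ n] scalar_prod_add_distrib[of _ n] algebra_simps)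
  moreover have "a \<bullet> a + b \<bullet> b > 0"
    using ne ab scalar_prod_self_pos[of a n] scalar_prod_self_pos[of b n]
    by (cases "a = 0\<^sub>v n"; cases "b = 0\<^sub>v n") (auto intro: add_pos_pos)
  ultimately have "Im l = 0" by simp
  then have "A *\<^sub>v a = Re l \<cdot>\<^sub>v a" "A *\<^sub>v b = Re l \<cdot>\<^sub>v b"
    using Aa Ab ab by auto
  with ne ab that show thesis by blast
qed

text \<open>For \<open>v = e\<^sub>1\<close> the scaling factor is the junk value \<open>2 / 0 = 0\<close>, and \<open>W\<close> is the identity.\<close>

lemma householder:
  fixes v :: "real vec"
  assumes v: "v \<in> carrier_vec n" and unit: "v \<bullet> v = 1" and n: "n > 0"
  obtains W where "W \<in> carrier_mat n n" "transpose_mat W = W" "W * W = 1\<^sub>m n" "col W 0 = v"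
proof -
  \<comment> \<open>\<open>w\<close> is v - e_1 and \<open>s\<close> its squared length. If w is
    nonzero, \<open>W\<close> is the reflection I - 2 w w^T / s, which exchanges e_1 and the unit
    vector \<open>v\<close>.\<close>
  define w where "w = (\<lambda>i. v $ i - (if i = 0 then 1 else 0))"
  define s where "s = (\<Sum>i<n. w i * w i)"
  define c where "c = 2 / s"
  define W where "W = mat n n (\<lambda>(i,j). (if i = j then 1 else 0) - c * w i * w j)"
  have W: "W \<in> carrier_mat n n" by (simp add: W_def)
  have WT: "transpose_mat W = W" by (intro eq_matI) (auto simp: W_def)
  have w0: "w i = 0" if "s = 0" "i < n" for i
    using that sum_nonneg_eq_0_iff[of "{..<n}" "\<lambda>i. w i * w i"] unfolding s_def by auto
  have ccs: "c * c * s = 2 * c" by (cases "s = 0") (auto simp: c_def)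
  have "W * W = 1\<^sub>m n"
  proof (rule eq_matI)
    fix i j assume "i < dim_row (1\<^sub>m n)" "j < dim_col (1\<^sub>m n)"
    then have ij: "i < n" "j < n" by auto
    have "(W * W) $$ (i,j) = (\<Sum>k<n. ((if i = k then 1 else 0) - c * w i * w k) *
        ((if k = j then 1 else 0) - c * w k * w j))"
      using ij by (simp add: W_def scalar_prod_def lessThan_atLeast0)
    also have "\<dots> = (\<Sum>k<n. (if i = k then if k = j then 1 else 0 else 0)
        - (if i = k then c * w k * w j else 0) - (if k = j then c * w i * w k else 0)
        + c * c * w i * w j * (w k * w k))"
      by (intro sum.cong refl) (auto simp: algebra_simps)
    also have "\<dots> = (if i = j then 1 else 0) - c * w i * w j - c * w i * w j
        + c * c * w i * w j * s"
      using ij by (simp add: sum.distrib sum_subtractf s_def sum_distrib_left)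
    also have "\<dots> = (if i = j then 1 else 0) + w i * w j * (c * c * s - 2 * c)"
      by (simp add: algebra_simps)
    finally show "(W * W) $$ (i,j) = 1\<^sub>m n $$ (i,j)" using ij ccs by simp
  qed (auto simp: W_def)
  moreover have "col W 0 = v"
  proof (rule eq_vecI)
    have vv: "(\<Sum>i<n. v $ i * v $ i) = 1"
      using unit v by (simp add: scalar_prod_def lessThan_atLeast0)
    \<comment> \<open>Since v has length 1, s = |v - e_1|^2 = 2 - 2 v_0 = -2 w_0. Hence c w_0 = -1
      unless s = 0, and column 0 of \<open>W\<close> is e_1 + w = v.\<close>
    have "s = (\<Sum>i<n. v $ i * v $ i + (if i = 0 then 1 - 2 * v $ i else 0))"
      unfolding s_def by (intro sum.cong refl) (auto simp: w_def algebra_simps)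
    also have "\<dots> = - 2 * w 0" using n vv by (simp add: sum.distrib w_def)
    finally have s: "s = - 2 * w 0" .
    have cw: "c * w i * w 0 = - w i" if "i < n" for i
      using w0[OF _ that] s by (cases "s = 0") (auto simp: c_def field_simps)
    fix i assume "i < dim_vec v"
    then have i: "i < n" using v by simp
    show "col W 0 $ i = v $ i" using i n cw[OF i] by (simp add: W_def w_def)
  qed (use v in \<open>auto simp: W_def\<close>)
  ultimately show thesis using that W WT by blast
qed

text \<open>Induction by deflation. Conjugating with a reflection \<open>W\<close> that takes e_1 to
  a unit eigenvector makes the first column of W A W a multiple of e_1. By symmetry the same holds
  for the first row, and the remaining block is symmetric of size n.\<close>

lemma spectral_decomposition:
  fixes A :: "real mat"
  assumes "A \<in> carrier_mat n n" "transpose_mat A = A"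
  shows "\<exists>U D. U \<in> carrier_mat n n \<and> D \<in> carrier_mat n n \<and> diagonal_mat D \<and>
    transpose_mat U * U = 1\<^sub>m n \<and> A = U * D * transpose_mat U"
  using assms
proof (induction n arbitrary: A)
  case 0
  then show ?case
    by (intro exI[of _ "1\<^sub>m 0"]) (auto simp: diagonal_mat_def)
next
  case (Suc n)
  note A = Suc.prems(1)
  obtain e u where u: "u \<in> carrier_vec (Suc n)" "u \<noteq> 0\<^sub>v (Suc n)" "A *\<^sub>v u = e \<cdot>\<^sub>v u"
    using symmetric_real_eigenvalue[OF Suc.prems] by blast
  define v where "v = (1 / sqrt (u \<bullet> u)) \<cdot>\<^sub>v u"
  have v: "v \<in> carrier_vec (Suc n)" using u by (simp add: v_def)
  have "v \<bullet> v = 1" using u scalar_prod_self_pos[OF u(1,2)] by (simp add: v_def field_simps)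
  then obtain W where W: "W \<in> carrier_mat (Suc n) (Suc n)" "transpose_mat W = W"
    "W * W = 1\<^sub>m (Suc n)" "col W 0 = v"
    using householder[OF v] by blast
  have Av: "A *\<^sub>v v = e \<cdot>\<^sub>v v"
    using u A by (simp add: v_def mult_mat_vec[OF A u(1)] smult_smult_assoc mult.commute)
  define B where "B = W * A * W"
  have B: "B \<in> carrier_mat (Suc n) (Suc n)" using W A by (simp add: B_def)
  have BT: "transpose_mat B = B"
    using W A Suc.prems(2) unfolding B_def
    by (simp add: transpose_mult[of _ "Suc n" "Suc n" _ "Suc n"] assoc_mult_mat[of _ "Suc n" "Suc n" _ "Suc n" _ "Suc n"])
  have WBW: "A = W * B * W"
  proof -
    have "W * B * W = (W * W) * A * (W * W)" unfolding B_def using W(1) A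
      by (simp add: assoc_mult_mat[of _ "Suc n" "Suc n" _ "Suc n" _ "Suc n"])
    then show ?thesis using W(3) A by simp
  qed
  \<comment> \<open>W e_1 = v is an eigenvector and W W = 1, so B e_1 = W A v = e W v = e W W e_1 =
    e e_1.\<close>
  have colB: "B $$ (i, 0) = (if i = 0 then e else 0)" if i: "i < Suc n" for i
  proof -
    have "col B 0 = W *\<^sub>v (A *\<^sub>v col W 0)"
      unfolding B_def using W(1) A
      by (simp add: col_mult2[of _ "Suc n" "Suc n" _ "Suc n"]) (simp add: mult_mat_vec_def)
    also have "\<dots> = e \<cdot>\<^sub>v (W *\<^sub>v col W 0)"
      using W Av v by (simp add: mult_mat_vec[of W "Suc n" "Suc n"])
    also have "W *\<^sub>v col W 0 = col (W * W) 0"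
      using W(1) by (simp add: col_mult2[of _ "Suc n" "Suc n" _ "Suc n"]) (simp add: mult_mat_vec_def)
    finally have "col B 0 $ i = (e \<cdot>\<^sub>v unit_vec (Suc n) 0) $ i" using W(3) by simp
    then show ?thesis using B i by (auto simp: unit_vec_def)
  qed
  define C where "C = mat n n (\<lambda>(i,j). B $$ (Suc i, Suc j))"
  have C: "C \<in> carrier_mat n n" by (simp add: C_def)
  have BTij: "B $$ (i,j) = B $$ (j,i)" if "i < Suc n" "j < Suc n" for i j
    using arg_cong[OF BT, of "\<lambda>M. M $$ (j,i)"] that B by simp
  have "transpose_mat C = C"
    by (intro eq_matI) (auto simp: C_def BTij)
  from Suc.IH[OF C this] obtain V D where V: "V \<in> carrier_mat n n" "D \<in> carrier_mat n n"
    "diagonal_mat D" "transpose_mat V * V = 1\<^sub>m n" "C = V * D * transpose_mat V" by blast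
  let ?E = "mat 1 1 (\<lambda>_. e)"
  \<comment> \<open>\<open>?b X Y\<close> is block diagonal, and such matrices multiply blockwise.
    The decomposition of \<open>C\<close> therefore extends to \<open>B\<close>, with
    \<open>e\<close> as the first diagonal entry.\<close>
  let ?b = "\<lambda>X Y. four_block_mat X (0\<^sub>m 1 n) (0\<^sub>m n 1) Y"
  have bmult: "?b X Y * ?b X' Y' = ?b (X * X') (Y * Y')"
    if "X \<in> carrier_mat 1 1" "X' \<in> carrier_mat 1 1" "Y \<in> carrier_mat n n" "Y' \<in> carrier_mat n n"
    for X X' Y Y' :: "real mat"
    using that mult_four_block_mat[of X 1 1 "0\<^sub>m 1 n" n "0\<^sub>m n 1" n Y X' 1 "0\<^sub>m 1 n" n "0\<^sub>m n 1" Y']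
    by simp
  have Bblock: "B = ?b ?E C"
  proof (rule eq_matI)
    fix i j assume "i < dim_row (?b ?E C)" "j < dim_col (?b ?E C)"
    then have ij: "i < Suc n" "j < Suc n" using C by auto
    then show "B $$ (i,j) = ?b ?E C $$ (i,j)"
      using colB[of i] colB[of j] BTij[of i j] C
      by (cases i; cases j) (auto simp: C_def)
  qed (use B C in auto)
  let ?V = "?b (1\<^sub>m 1) V" and ?D = "?b ?E D"
  have VT: "transpose_mat ?V = ?b (1\<^sub>m 1) (transpose_mat V)"
    using V(1) by (subst transpose_four_block_mat[of _ 1 1 _ n _ n]) auto
  have V': "?V \<in> carrier_mat (Suc n) (Suc n)" "?D \<in> carrier_mat (Suc n) (Suc n)"
    using V four_block_carrier_mat[of "1\<^sub>m 1" 1 1 V n n] four_block_carrier_mat[of ?E 1 1 D n n]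
    by auto
  have BV: "B = ?V * ?D * transpose_mat ?V"
  proof -
    have "?V * ?D = ?b (1\<^sub>m 1 * ?E) (V * D)" using V by (intro bmult) auto
    moreover have "?b (1\<^sub>m 1 * ?E) (V * D) * ?b (1\<^sub>m 1) (transpose_mat V)
        = ?b (1\<^sub>m 1 * ?E * 1\<^sub>m 1) (V * D * transpose_mat V)"
      using V by (intro bmult) auto
    moreover have "1\<^sub>m 1 * ?E * 1\<^sub>m 1 = ?E" by (intro eq_matI) auto
    ultimately show ?thesis unfolding VT Bblock V(5) by metis
  qed
  have VV: "transpose_mat ?V * ?V = 1\<^sub>m (Suc n)"
    unfolding VT bmult[OF one_carrier_mat one_carrier_mat transpose_carrier_mat[THEN iffD2, OF V(1)] V(1)] V(4)
    by simp
  have diag: "diagonal_mat ?D"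
    using V(2,3) by (auto simp: diagonal_mat_def)
  define U where "U = W * ?V"
  have U: "U \<in> carrier_mat (Suc n) (Suc n)" using W V' by (simp add: U_def)
  have UT: "transpose_mat U = transpose_mat ?V * W"
    unfolding U_def using W V' by (simp add: transpose_mult[of _ "Suc n" "Suc n" _ "Suc n"])
  have VT': "transpose_mat ?V \<in> carrier_mat (Suc n) (Suc n)" using V' by simp
  note assoc = assoc_mult_mat[of _ "Suc n" "Suc n" _ "Suc n" _ "Suc n"]
  have "transpose_mat U * U = transpose_mat ?V * (W * W) * ?V"
    unfolding UT unfolding U_def using W(1) V' VT' by (simp add: assoc del: transpose_carrier_mat)
  then have "transpose_mat U * U = 1\<^sub>m (Suc n)" unfolding W(3) right_mult_one_mat[OF VT'] VV .
  moreover have "A = U * ?D * transpose_mat U"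
    unfolding UT unfolding WBW BV U_def using W(1) V' VT' by (simp add: assoc)
  ultimately show ?case using U V' diag by blast
qed

section \<open>Uniqueness and existence of the Moore-Penrose inverse\<close>

text \<open>A B = (A C) (A B) with both factors symmetric; transposing swaps them and gives (A B) (A
  C) = A C. In the same way B A = C A. Then B = B A B = C A B = C A C = C.\<close>

lemma is_moore_penrose_unique:
  assumes "is_moore_penrose A B" "is_moore_penrose A C"
  shows "B = C"
proof -
  let ?m = "dim_row A" and ?n = "dim_col A"
  have A: "A \<in> carrier_mat ?m ?n" by simp
  have B: "B \<in> carrier_mat ?n ?m" "A * B * A = A" "B * A * B = B"
    "transpose_mat (A * B) = A * B" "transpose_mat (B * A) = B * A"
    using assms(1) by (auto simp: is_moore_penrose_def)
  have C: "C \<in> carrier_mat ?n ?m" "A * C * A = A" "C * A * C = C"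
    "transpose_mat (A * C) = A * C" "transpose_mat (C * A) = C * A"
    using assms(2) by (auto simp: is_moore_penrose_def)
  have AB: "A * B \<in> carrier_mat ?m ?m" "A * C \<in> carrier_mat ?m ?m"
    "B * A \<in> carrier_mat ?n ?n" "C * A \<in> carrier_mat ?n ?n" using B(1) C(1) by auto
  have "A * B = (A * C) * (A * B)"
    using assoc_mult_mat[OF AB(2) A B(1)] C(2) by simp
  then have "A * B = transpose_mat ((A * C) * (A * B))" using B(4) by simp
  also have "\<dots> = (A * B) * (A * C)"
    unfolding transpose_mult[OF AB(2,1)] B(4) C(4) ..
  also have "\<dots> = A * C"
    using assoc_mult_mat[OF AB(1) A C(1)] B(2) by simp
  finally have 1: "A * B = A * C" .
  have "B * A = (B * A) * (C * A)"
    using assoc_mult_mat[OF B(1) A AB(4)] assoc_mult_mat[OF A C(1) A] C(2) by simp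
  then have "B * A = transpose_mat ((B * A) * (C * A))" using B(5) by simp
  also have "\<dots> = (C * A) * (B * A)"
    unfolding transpose_mult[OF AB(3,4)] B(5) C(5) ..
  also have "\<dots> = C * A"
    using assoc_mult_mat[OF C(1) A AB(3)] assoc_mult_mat[OF A B(1) A] B(2) by simp
  finally have 2: "B * A = C * A" .
  have "B = C * A * B" using B(3) 2 by simp
  also have "\<dots> = C * (A * C)" using assoc_mult_mat[OF C(1) A B(1)] 1 by simp
  also have "\<dots> = C" using assoc_mult_mat[OF C(1) A C(1)] C(3) by simp
  finally show ?thesis .
qed

lemma moore_penrose_eqI: "is_moore_penrose A B \<Longrightarrow> moore_penrose A = B"
  unfolding moore_penrose_def using is_moore_penrose_unique by blast

lemma diagonal_mat_mult:
  fixes D E :: "'a :: comm_ring_1 mat"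
  assumes "D \<in> carrier_mat n n" "E \<in> carrier_mat n n" "diagonal_mat D" "diagonal_mat E"
  shows "D * E = mat n n (\<lambda>(i,j). if i = j then D $$ (i,i) * E $$ (i,i) else 0)"
proof (rule eq_matI)
  fix i j assume "i < dim_row (mat n n (\<lambda>(i,j). if i = j then D $$ (i,i) * E $$ (i,i) else 0))"
    "j < dim_col (mat n n (\<lambda>(i,j). if i = j then D $$ (i,i) * E $$ (i,i) else 0))"
  then have ij: "i < n" "j < n" by auto
  have "(D * E) $$ (i,j) = (\<Sum>k<n. D $$ (i,k) * E $$ (k,j))"
    using ij assms by (simp add: scalar_prod_def lessThan_atLeast0)
  also have "\<dots> = (\<Sum>k<n. if k = i then (if i = j then D $$ (i,i) * E $$ (i,i) else 0) else 0)"
    using ij assms by (intro sum.cong refl) (auto simp: diagonal_mat_def)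
  finally show "(D * E) $$ (i,j) = mat n n (\<lambda>(i,j). if i = j then D $$ (i,i) * E $$ (i,i) else 0) $$ (i,j)"
    using ij by simp
qed (use assms in auto)

text \<open>Conjugation \<open>f X\<close> = U X U^T with the orthogonal factor is multiplicative
  and commutes with transposition. The Penrose equations for \<open>A\<close> thus reduce to those
  for the diagonal matrix \<open>D\<close>. Symmetry of the inverse carries over from the diagonal
  matrix \<open>E\<close>.\<close>

lemma is_moore_penrose_symmetric:
  assumes "A \<in> carrier_mat n n" "transpose_mat A = A"
  shows "is_moore_penrose A (moore_penrose A)" "transpose_mat (moore_penrose A) = moore_penrose A"
proof -
  obtain U D where UD: "U \<in> carrier_mat n n" "D \<in> carrier_mat n n" "diagonal_mat D"
    "transpose_mat U * U = 1\<^sub>m n" "A = U * D * transpose_mat U"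
    using spectral_decomposition[OF assms] by blast
  \<comment> \<open>Because \<open>1 / 0 = 0\<close>, this inverts the nonzero diagonal entries and
    keeps the zeros, as a pseudo-inverse of \<open>D\<close> should.\<close>
  define E where "E = mat n n (\<lambda>(i,j). if i = j then 1 / D $$ (i,i) else 0)"
  have E: "E \<in> carrier_mat n n" "diagonal_mat E" by (auto simp: E_def diagonal_mat_def)
  have E_entry: "E $$ (i,j) = (if i = j then 1 / D $$ (i,i) else 0)" if "i < n" "j < n" for i j
    using that by (simp add: E_def)
  define f where "f X = U * X * transpose_mat U" for X
  have UT: "transpose_mat U \<in> carrier_mat n n" using UD by simp
  have fc: "f X \<in> carrier_mat n n" if "X \<in> carrier_mat n n" for X
    using that UD unfolding f_def by auto
  note assoc = assoc_mult_mat[of _ n n _ n _ n]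
  have fm: "f X * f Y = f (X * Y)" if XY: "X \<in> carrier_mat n n" "Y \<in> carrier_mat n n" for X Y
  proof -
    have "f X * f Y = U * X * (transpose_mat U * U) * Y * transpose_mat U"
      unfolding f_def using XY UD(1) UT by (simp add: assoc del: transpose_carrier_mat)
    also have "\<dots> = f (X * Y)" unfolding UD(4) f_def using XY UD(1) UT
      by (simp add: assoc del: transpose_carrier_mat)
    finally show ?thesis .
  qed
  have fT: "transpose_mat (f X) = f (transpose_mat X)" if X: "X \<in> carrier_mat n n" for X
    unfolding f_def using X UD(1) by (simp add: transpose_mult[of _ n n _ n] assoc)
  have diagT: "transpose_mat X = X" if "X \<in> carrier_mat n n" "diagonal_mat X" for X :: "real mat"
    using that by (intro eq_matI) (auto simp: diagonal_mat_def, metis)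
  have DE: "D * E = mat n n (\<lambda>(i,j). if i = j then if D $$ (i,i) = 0 then 0 else 1 else 0)"
    unfolding diagonal_mat_mult[OF UD(2) E(1) UD(3) E(2)] by (intro eq_matI) (auto simp: E_def)
  have ED: "E * D = D * E"
    using diagonal_mat_mult[OF UD(2) E(1) UD(3) E(2)] diagonal_mat_mult[OF E(1) UD(2) E(2) UD(3)]
    by (auto intro!: eq_matI)
  have DEc: "D * E \<in> carrier_mat n n" "diagonal_mat (D * E)"
    unfolding DE by (auto simp: diagonal_mat_def)
  have DED: "D * E * D = D"
    unfolding diagonal_mat_mult[OF DEc(1) UD(2) DEc(2) UD(3)] using UD(2,3)
    by (intro eq_matI) (auto simp: DE diagonal_mat_def)
  have EDE: "D * E * E = E"
    unfolding diagonal_mat_mult[OF DEc(1) E(1) DEc(2) E(2)]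
    using E by (intro eq_matI) (auto simp: DE E_entry)
  have A: "A = f D" by (simp add: f_def UD)
  have mp: "is_moore_penrose A (f E)"
    unfolding is_moore_penrose_def A
    using fc[OF E(1)] fc[OF UD(2)] DEc UD(2) E(1)
    by (simp add: fm fT diagT ED DED EDE)
  then show "is_moore_penrose A (moore_penrose A)" using moore_penrose_eqI by metis
  show "transpose_mat (moore_penrose A) = moore_penrose A"
    unfolding moore_penrose_eqI[OF mp] using fT[OF E(1)] diagT[OF E] by simp
qed

section \<open>Rayleigh bound for the largest eigenvalue\<close>

text \<open>In the coordinates y = U^T x the quadratic form is the sum of D_ii y_i^2, while x
  \<bullet> x is the sum of y_i^2. Each D_ii is an eigenvalue of \<open>A\<close>, hence at most the
  maximum of the finite spectrum. For n = 0 both sides are 0 whatever \<open>Max {}\<close>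
  is.\<close>

lemma largest_eigenvalue_Rayleigh:
  assumes A: "A \<in> carrier_mat n n" and sym: "transpose_mat A = A" and x: "x \<in> carrier_vec n"
  shows "x \<bullet> (A *\<^sub>v x) \<le> largest_eigenvalue A * (x \<bullet> x)"
proof -
  obtain U D where UD: "U \<in> carrier_mat n n" "D \<in> carrier_mat n n" "diagonal_mat D"
    "transpose_mat U * U = 1\<^sub>m n" "A = U * D * transpose_mat U"
    using spectral_decomposition[OF A sym] by blast
  have UT: "transpose_mat U \<in> carrier_mat n n" using UD by simp
  have UU: "U * transpose_mat U = 1\<^sub>m n"
    using mat_mult_left_right_inverse[OF UT UD(1) UD(4)] .
  define y where "y = transpose_mat U *\<^sub>v x"
  have y: "y \<in> carrier_vec n" using UT x by (simp add: y_def)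
  have "U *\<^sub>v y = (U * transpose_mat U) *\<^sub>v x"
    unfolding y_def using UD(1) UT x by (simp add: assoc_mult_mat_vec[of _ n n _ n] del: transpose_carrier_mat)
  then have xy: "x = U *\<^sub>v y" using UU x by simp
  have Dy: "D *\<^sub>v y \<in> carrier_vec n" using UD y by simp
  have Ax: "A *\<^sub>v x = U *\<^sub>v (D *\<^sub>v y)"
    unfolding UD(5) y_def using UD(1,2) UT x
    by (simp add: assoc_mult_mat_vec[of _ n n _ n] assoc_mult_mat[of _ n n _ n _ n] del: transpose_carrier_mat)
  have iso: "(U *\<^sub>v z) \<bullet> x = z \<bullet> y" if z: "z \<in> carrier_vec n" for z
    using transpose_vec_mult_scalar[OF UD(1) z x] x y z UD(1)
    by (metis comm_scalar_prod mult_mat_vec_carrier y_def)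
  have yy: "x \<bullet> x = (\<Sum>i<n. y $ i * y $ i)"
    using iso[OF y] xy y by (simp add: scalar_prod_def lessThan_atLeast0)
  have Dyi: "(D *\<^sub>v y) $ i = D $$ (i,i) * y $ i" if i: "i < n" for i
  proof -
    have "(D *\<^sub>v y) $ i = (\<Sum>k<n. D $$ (i,k) * y $ k)"
      using i UD(2) y by (simp add: scalar_prod_def lessThan_atLeast0 row_def)
    also have "\<dots> = (\<Sum>k<n. if k = i then D $$ (i,i) * y $ i else 0)"
      using i UD(2,3) by (intro sum.cong refl) (auto simp: diagonal_mat_def)
    finally show ?thesis using i by simp
  qed
  have "x \<bullet> (A *\<^sub>v x) = (D *\<^sub>v y) \<bullet> y"
    using iso[OF Dy] Ax x A by (metis comm_scalar_prod mult_mat_vec_carrier)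
  also have "\<dots> = (\<Sum>i<n. (D *\<^sub>v y) $ i * y $ i)"
    using y by (simp add: scalar_prod_def lessThan_atLeast0)
  also have "\<dots> = (\<Sum>i<n. D $$ (i,i) * y $ i * y $ i)"
    by (intro sum.cong refl) (simp add: Dyi)
  also have "\<dots> \<le> (\<Sum>i<n. largest_eigenvalue A * (y $ i * y $ i))"
  proof (rule sum_mono)
    fix i assume "i \<in> {..<n}"
    then have i: "i < n" by simp
    \<comment> \<open>Column i of \<open>U\<close> is an eigenvector for D_ii; it is nonzero because
      U^T maps it back to the unit vector.\<close>
    have u: "unit_vec n i \<in> carrier_vec n" by simp
    have De: "D *\<^sub>v unit_vec n i = D $$ (i,i) \<cdot>\<^sub>v unit_vec n i"
      using UD(2,3) i by (intro eq_vecI) (auto simp: diagonal_mat_def)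
    have Ue: "transpose_mat U *\<^sub>v (U *\<^sub>v unit_vec n i) = unit_vec n i"
      using assoc_mult_mat_vec[OF UT UD(1) u] UD(4) by simp
    have "A *\<^sub>v (U *\<^sub>v unit_vec n i) = U *\<^sub>v (D *\<^sub>v (transpose_mat U *\<^sub>v (U *\<^sub>v unit_vec n i)))"
      unfolding UD(5) using UD(1,2) UT
      by (simp add: assoc_mult_mat_vec[of _ n n _ n] assoc_mult_mat[of _ n n _ n _ n] del: transpose_carrier_mat)
    also have "\<dots> = D $$ (i,i) \<cdot>\<^sub>v (U *\<^sub>v unit_vec n i)"
      unfolding Ue De using UD(1) u by (rule mult_mat_vec)
    finally have "A *\<^sub>v (U *\<^sub>v unit_vec n i) = D $$ (i,i) \<cdot>\<^sub>v (U *\<^sub>v unit_vec n i)" .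
    moreover have "U *\<^sub>v unit_vec n i \<noteq> 0\<^sub>v n"
    proof
      assume "U *\<^sub>v unit_vec n i = 0\<^sub>v n"
      moreover have "transpose_mat U *\<^sub>v 0\<^sub>v n = 0\<^sub>v n" using UT by (intro eq_vecI) auto
      ultimately have "unit_vec n i = (0\<^sub>v n :: real vec)" using Ue by simp
      then show False using i by (metis index_unit_vec(1) index_zero_vec(1) zero_neq_one)
    qed
    ultimately have "D $$ (i,i) \<in> spectrum A"
      unfolding spectrum_def eigenvalue_def eigenvector_def using A UD(1) u
      by (auto intro!: exI[of _ "U *\<^sub>v unit_vec n i"])
    then have "D $$ (i,i) \<le> largest_eigenvalue A"
      unfolding largest_eigenvalue_def using card_finite_spectrum(1)[OF A] by simp
    then show "D $$ (i,i) * y $ i * y $ i \<le> largest_eigenvalue A * (y $ i * y $ i)"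
      by (simp add: mult.assoc mult_right_mono)
  qed
  finally show ?thesis by (simp add: yy sum_distrib_left)
qed

text \<open>The Rayleigh bound at a unit vector. It shows that the largest eigenvalue of a Gram
  matrix is nonnegative, and later that all affinities are 1 when the largest eigenvalues
  vanish.\<close>

lemma diagonal_le_largest_eigenvalue:
  assumes A: "A \<in> carrier_mat n n" and sym: "transpose_mat A = A" and i: "i < n"
  shows "A $$ (i,i) \<le> largest_eigenvalue A"
  using largest_eigenvalue_Rayleigh[OF A sym, of "unit_vec n i"] A i
  by simp

subsection \<open>Gram matrices of square integrable functions\<close>

lemma integrable_mult_square_integrable:
  fixes f g :: "'a \<Rightarrow> real"
  assumes [measurable]: "f \<in> borel_measurable M" "g \<in> borel_measurable M"
    and "integrable M (\<lambda>x. (f x)\<^sup>2)" "integrable M (\<lambda>x. (g x)\<^sup>2)"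
  shows "integrable M (\<lambda>x. f x * g x)"
proof (rule Bochner_Integration.integrable_bound)
  show "integrable M (\<lambda>x. (f x)\<^sup>2 + (g x)\<^sup>2)" using assms by simp
  have "\<bar>a * b\<bar> \<le> a\<^sup>2 + b\<^sup>2" for a b :: real
    using sum_squares_bound[of "\<bar>a\<bar>" "\<bar>b\<bar>"] 
      mult_nonneg_nonneg[OF abs_ge_zero[of a] abs_ge_zero[of b]]
    unfolding abs_mult power2_abs by linarith
  then show "AE x in M. norm (f x * g x) \<le> norm ((f x)\<^sup>2 + (g x)\<^sup>2)" by simp
qed simp

text \<open>The integral of (t f + g)^2 is a nonnegative quadratic polynomial in t. Its value at the
  minimiser t = -b/a gives the claim; for a = 0 the polynomial is affine, which forces b =
  0.\<close>

lemma integral_Cauchy_Schwarz: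
  fixes f g :: "'a \<Rightarrow> real"
  assumes meas: "f \<in> borel_measurable M" "g \<in> borel_measurable M"
    and sq: "integrable M (\<lambda>x. (f x)\<^sup>2)" "integrable M (\<lambda>x. (g x)\<^sup>2)"
  shows "(\<integral>x. f x * g x \<partial>M)\<^sup>2 \<le> (\<integral>x. (f x)\<^sup>2 \<partial>M) * (\<integral>x. (g x)\<^sup>2 \<partial>M)"
proof -
  define a b c where "a = (\<integral>x. (f x)\<^sup>2 \<partial>M)" and "b = (\<integral>x. f x * g x \<partial>M)"
    and "c = (\<integral>x. (g x)\<^sup>2 \<partial>M)"
  note fg = integrable_mult_square_integrable[OF meas sq]
  have quad: "0 \<le> t\<^sup>2 * a + 2 * t * b + c" for t
  proof -
    have "0 \<le> (\<integral>x. (t * f x + g x)\<^sup>2 \<partial>M)" by simp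
    also have "\<dots> = (\<integral>x. t\<^sup>2 * (f x)\<^sup>2 + 2 * t * (f x * g x) + (g x)\<^sup>2 \<partial>M)"
      by (intro Bochner_Integration.integral_cong) (auto simp: power2_eq_square algebra_simps)
    also have "\<dots> = t\<^sup>2 * a + 2 * t * b + c"
      unfolding a_def b_def c_def using sq fg by simp
    finally show ?thesis .
  qed
  have "a \<ge> 0" by (simp add: a_def)
  have "b\<^sup>2 \<le> a * c"
  proof (cases "a = 0")
    case True
    have "b = 0"
    proof (rule ccontr)
      \<comment> \<open>At this t the affine function 2 t b + c takes the value -1.\<close>
      assume "b \<noteq> 0"
      then show False using quad[of "- (c + 1) / (2 * b)"] True by (simp add: field_simps)
    qed
    then show ?thesis using True by simp
  next
    case False
    then show ?thesis using quad[of "- b / a"] \<open>a \<ge> 0\<close>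
      by (simp add: power2_eq_square field_simps)
  qed
  then show ?thesis by (simp add: a_def b_def c_def)
qed

section \<open>The abstract Gram matrix estimates\<close>

text \<open>\<open>G\<close> and \<open>w\<close> are parameters fixed by their entries, so that the
  chi-square and Hellinger matrices can be inserted directly, once their entries are recognised as
  inner products.\<close>

locale gram =
  fixes M :: "'a measure" and n :: nat and g :: "nat \<Rightarrow> 'a \<Rightarrow> real" and h :: "'a \<Rightarrow> real"
    and G :: "real mat" and w :: "real vec"
  assumes g_meas [measurable]: "\<And>i. i < n \<Longrightarrow> g i \<in> borel_measurable M"
    and h_meas [measurable]: "h \<in> borel_measurable M"
    and g_sq: "\<And>i. i < n \<Longrightarrow> integrable M (\<lambda>x. (g i x)\<^sup>2)"
    and h_sq: "integrable M (\<lambda>x. (h x)\<^sup>2)"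
    and G: "G \<in> carrier_mat n n"
    and G_entry: "\<And>i j. i < n \<Longrightarrow> j < n \<Longrightarrow> G $$ (i,j) = (\<integral>x. g i x * g j x \<partial>M)"
    and w: "w \<in> carrier_vec n"
    and w_entry: "\<And>i. i < n \<Longrightarrow> w $ i = (\<integral>x. g i x * h x \<partial>M)"
begin

lemma symmetric: "transpose_mat G = G"
  using G by (intro eq_matI) (auto simp: G_entry mult.commute)

lemma bilinear_bound:
  assumes c: "c \<in> carrier_vec n"
  shows "(c \<bullet> w)\<^sup>2 \<le> (c \<bullet> (G *\<^sub>v c)) * (\<integral>x. (h x)\<^sup>2 \<partial>M)"
proof -
  define f where "f x = (\<Sum>i<n. c $ i * g i x)" for x
  have gg: "integrable M (\<lambda>x. g i x * g j x)" if "i < n" "j < n" for i j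
    using that g_meas g_sq integrable_mult_square_integrable by blast
  have gh: "integrable M (\<lambda>x. g i x * h x)" if "i < n" for i
    using that g_meas g_sq h_meas h_sq integrable_mult_square_integrable by blast
  have f_meas: "f \<in> borel_measurable M"
    unfolding f_def by (intro borel_measurable_sum borel_measurable_times) auto
  have f2: "(f x)\<^sup>2 = (\<Sum>i<n. \<Sum>j<n. c $ i * c $ j * (g i x * g j x))" for x
    unfolding f_def power2_eq_square sum_product by (intro sum.cong refl) simp
  have f_sq: "integrable M (\<lambda>x. (f x)\<^sup>2)"
    unfolding f2 by (intro Bochner_Integration.integrable_sum integrable_mult_right) (auto intro: gg)
  have "(\<integral>x. (f x)\<^sup>2 \<partial>M) = (\<Sum>i<n. \<Sum>j<n. c $ i * c $ j * (\<integral>x. g i x * g j x \<partial>M))"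
    unfolding f2
    by (subst Bochner_Integration.integral_sum)
      (auto intro!: Bochner_Integration.integrable_sum integrable_mult_right gg
        simp: Bochner_Integration.integral_sum integrable_mult_right gg)
  also have "\<dots> = (\<Sum>i<n. c $ i * (\<Sum>j<n. G $$ (i,j) * c $ j))"
    unfolding sum_distrib_left by (intro sum.cong refl) (simp add: G_entry)
  also have "\<dots> = c \<bullet> (G *\<^sub>v c)"
    using G c by (simp add: scalar_prod_def lessThan_atLeast0 row_def)
  finally have 1: "(\<integral>x. (f x)\<^sup>2 \<partial>M) = c \<bullet> (G *\<^sub>v c)" .
  have "(\<integral>x. f x * h x \<partial>M) = (\<integral>x. (\<Sum>i<n. c $ i * (g i x * h x)) \<partial>M)"
    by (simp add: f_def sum_distrib_right mult.assoc)
  also have "\<dots> = (\<Sum>i<n. c $ i * w $ i)"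
    using gh by (simp add: Bochner_Integration.integral_sum w_entry)
  also have "\<dots> = c \<bullet> w"
    using w by (simp add: scalar_prod_def lessThan_atLeast0)
  finally have 2: "(\<integral>x. f x * h x \<partial>M) = c \<bullet> w" .
  show ?thesis using integral_Cauchy_Schwarz[OF f_meas h_meas f_sq h_sq] unfolding 1 2 .
qed

text \<open>For c = B w with B the symmetric Moore-Penrose inverse, B G B = B turns c \<bullet> G c
  into t = w \<bullet> c. The bilinear bound then reads t^2 \<le> t |h|^2.\<close>

lemma moore_penrose_bound: "w \<bullet> (moore_penrose G *\<^sub>v w) \<le> (\<integral>x. (h x)\<^sup>2 \<partial>M)"
proof -
  define B where "B = moore_penrose G"
  have "is_moore_penrose G B" and BT: "transpose_mat B = B"
    using is_moore_penrose_symmetric[OF G symmetric] by (auto simp: B_def)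
  then have B: "B \<in> carrier_mat n n" "B * G * B = B"
    using G by (auto simp: is_moore_penrose_def)
  define c where "c = B *\<^sub>v w"
  have c: "c \<in> carrier_vec n" using B w by (simp add: c_def)
  have "c \<bullet> (G *\<^sub>v c) = w \<bullet> (B *\<^sub>v (G *\<^sub>v c))"
    using transpose_vec_mult_scalar[OF B(1) mult_mat_vec_carrier[OF G c] w] BT
      comm_scalar_prod[OF w mult_mat_vec_carrier[OF B(1) mult_mat_vec_carrier[OF G c]]]
      comm_scalar_prod[OF c mult_mat_vec_carrier[OF G c]]
    by (simp add: c_def)
  also have "B *\<^sub>v (G *\<^sub>v c) = (B * G * B) *\<^sub>v w"
    unfolding c_def using B(1) G w by (simp add: assoc_mult_mat_vec[of _ n n _ n])
  finally have "c \<bullet> (G *\<^sub>v c) = w \<bullet> c" using B by (simp add: c_def)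
  then have "(w \<bullet> c)\<^sup>2 \<le> (w \<bullet> c) * (\<integral>x. (h x)\<^sup>2 \<partial>M)"
    using bilinear_bound[OF c] comm_scalar_prod[OF c w] by simp
  moreover have "0 \<le> (\<integral>x. (h x)\<^sup>2 \<partial>M)" by simp
  \<comment> \<open>A positive t cancels; otherwise t \<le> 0 \<le> |h|^2.\<close>
  ultimately have "w \<bullet> c \<le> (\<integral>x. (h x)\<^sup>2 \<partial>M)"
    unfolding power2_eq_square[of "w \<bullet> c"]
    by (cases "w \<bullet> c > 0") (metis mult_le_cancel_left_pos, linarith)
  then show ?thesis by (simp add: c_def B_def)
qed

lemma largest_eigenvalue_nonneg:
  assumes "n > 0"
  shows "0 \<le> largest_eigenvalue G"
proof -
  have "0 \<le> (\<integral>x. g 0 x * g 0 x \<partial>M)" by simp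
  also have "\<dots> = G $$ (0,0)" using assms by (simp add: G_entry)
  also have "\<dots> \<le> largest_eigenvalue G"
    by (rule diagonal_le_largest_eigenvalue[OF G symmetric assms])
  finally show ?thesis .
qed

text \<open>With c = w and t = w \<bullet> w, the bilinear and Rayleigh bounds give t^2 \<le>
  \<lambda> t |h|^2, where a positive t cancels. The case t = 0 rests on \<lambda> \<ge> 0, which
  holds since n > 0.\<close>

lemma largest_eigenvalue_bound:
  assumes "n > 0"
  shows "w \<bullet> w \<le> largest_eigenvalue G * (\<integral>x. (h x)\<^sup>2 \<partial>M)"
proof -
  let ?V = "\<integral>x. (h x)\<^sup>2 \<partial>M"
  have V: "0 \<le> ?V" by simp
  show ?thesis
  proof (cases "w \<bullet> w > 0")
    case True
    have "(w \<bullet> w)\<^sup>2 \<le> largest_eigenvalue G * (w \<bullet> w) * ?V"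
      using bilinear_bound[OF w] mult_right_mono[OF largest_eigenvalue_Rayleigh[OF G symmetric w] V]
      by linarith
    then have "(w \<bullet> w) * (w \<bullet> w) \<le> (w \<bullet> w) * (largest_eigenvalue G * ?V)"
      by (simp add: power2_eq_square mult_ac)
    then show ?thesis using True by (metis mult_le_cancel_left_pos)
  next
    case False
    then show ?thesis using mult_nonneg_nonneg[OF largest_eigenvalue_nonneg[OF assms] V] by linarith
  qed
qed

end

subsection \<open>The chi-square divergence matrix\<close>

lemma (in prob_space) integrable_if_square_integrable:
  fixes X :: "'a \<Rightarrow> real"
  assumes "X \<in> borel_measurable M" "integrable M (\<lambda>x. (X x)\<^sup>2)"
  shows "integrable M X"
  using integrable_mult_square_integrable[of X M "\<lambda>_. 1"] assms by simp

lemma (in prob_space) square_integrable_centered: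
  fixes X :: "'a \<Rightarrow> real"
  assumes "X \<in> borel_measurable M" "integrable M (\<lambda>x. (X x)\<^sup>2)"
  shows "integrable M (\<lambda>x. (X x - c)\<^sup>2)"
  using integrable_if_square_integrable[OF assms] assms(2) by (simp add: power2_diff)

text \<open>Let f_i be a real version of dP_i/dP_0. Since each f_i integrates to 1, the inner
  product of f_i - 1 and f_k - 1 is the integral of f_i f_k minus 1, a chi-square entry, and that of
  f_i - 1 with the centred X is the mean difference. If X is not square integrable, the right-hand
  side is infinite.\<close>

lemma chi2_lower_bound:
  fixes X :: "'a \<Rightarrow> real"
  assumes P0: "prob_space P\<^sub>0"
    and prob: "\<And>Q. Q \<in> set Ps \<Longrightarrow> prob_space Q"
    and sets: "\<And>Q. Q \<in> set Ps \<Longrightarrow> sets Q = sets P\<^sub>0"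
    and ac: "\<And>Q. Q \<in> set Ps \<Longrightarrow> absolutely_continuous P\<^sub>0 Q"
    and fin: "\<And>Q R. Q \<in> set Ps \<Longrightarrow> R \<in> set Ps \<Longrightarrow> chi2_integral P\<^sub>0 Q R < \<infinity>"
    and X [measurable]: "X \<in> borel_measurable P\<^sub>0"
    and \<Delta>: "\<Delta> \<in> carrier_vec (length Ps)"
    and \<Delta>_entry: "\<And>i. i < length Ps \<Longrightarrow> \<Delta> $ i = (\<integral>x. X x \<partial>(Ps ! i)) - (\<integral>x. X x \<partial>P\<^sub>0)"
  shows "ereal (\<Delta> \<bullet> (moore_penrose (chi2_matrix P\<^sub>0 Ps) *\<^sub>v \<Delta>)) \<le> ext_variance P\<^sub>0 X"
proof (cases "integrable P\<^sub>0 (\<lambda>x. (X x)\<^sup>2)")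
  case False
  then show ?thesis by (simp add: ext_variance_def)
next
  case X2: True
  interpret prob_space P\<^sub>0 by fact
  define f where "f i x = enn2real (RN_deriv P\<^sub>0 (Ps ! i) x)" for i x
  have f_meas [measurable]: "f i \<in> borel_measurable P\<^sub>0" for i
    unfolding f_def by measurable
  have f_nonneg: "f i x \<ge> 0" for i x by (simp add: f_def)
  \<comment> \<open>The derivative may take the value \<infinity>, but only on a null set because
    \<open>Ps ! i\<close> is \<sigma>-finite; so passing to real values loses nothing.\<close>
  have f_RN: "AE x in P\<^sub>0. RN_deriv P\<^sub>0 (Ps ! i) x = ennreal (f i x)" if i: "i < length Ps" for i
  proof -
    have Q: "Ps ! i \<in> set Ps" using i by simp
    interpret Q: prob_space "Ps ! i" by (rule prob[OF Q])
    show ?thesis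
      using RN_deriv_finite[OF Q.sigma_finite_measure_axioms ac[OF Q] sets[OF Q]]
      by eventually_elim (auto simp: f_def less_top)
  qed
  have dens: "Ps ! i = density P\<^sub>0 (\<lambda>x. ennreal (f i x))" if i: "i < length Ps" for i
  proof -
    have Q: "Ps ! i \<in> set Ps" using i by simp
    have "Ps ! i = density P\<^sub>0 (RN_deriv P\<^sub>0 (Ps ! i))"
      using density_RN_deriv[OF ac[OF Q] sets[OF Q]] by simp
    also have "\<dots> = density P\<^sub>0 (\<lambda>x. ennreal (f i x))"
      using f_RN[OF i] by (intro density_cong) auto
    finally show ?thesis .
  qed
  have int: "(\<integral>x. Y x \<partial>(Ps ! i)) = (\<integral>x. f i x * Y x \<partial>P\<^sub>0)"
    if "i < length Ps" "Y \<in> borel_measurable P\<^sub>0" for i and Y :: "'a \<Rightarrow> real"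
    unfolding dens[OF that(1)] using that(2) by (subst integral_density) (auto simp: f_nonneg)
  have chi2: "chi2_integral P\<^sub>0 (Ps ! i) (Ps ! k) = (\<integral>\<^sup>+x. ennreal (f i x * f k x) \<partial>P\<^sub>0)"
    if i: "i < length Ps" and k: "k < length Ps" for i k
  proof -
    have "chi2_integral P\<^sub>0 (Ps ! i) (Ps ! k) =
        (\<integral>\<^sup>+x. ennreal (f k x) * RN_deriv P\<^sub>0 (Ps ! i) x \<partial>P\<^sub>0)"
      unfolding chi2_integral_def by (subst dens[OF k]) (simp add: nn_integral_density)
    also have "\<dots> = (\<integral>\<^sup>+x. ennreal (f i x * f k x) \<partial>P\<^sub>0)"
      using f_RN[OF i] by (intro nn_integral_cong_AE, eventually_elim)
        (simp add: ennreal_mult f_nonneg mult.commute)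
    finally show ?thesis .
  qed
  \<comment> \<open>On the diagonal i = k, finiteness of the chi-square integrals puts the densities
    into L^2(P_0).\<close>
  have ff: "integrable P\<^sub>0 (\<lambda>x. f i x * f k x)" if i: "i < length Ps" and k: "k < length Ps" for i k
    using fin[of "Ps ! i" "Ps ! k"] i k chi2[OF i k]
    by (intro integrableI_nonneg) (auto simp: f_nonneg)
  have chi2': "enn2real (chi2_integral P\<^sub>0 (Ps ! i) (Ps ! k)) = (\<integral>x. f i x * f k x \<partial>P\<^sub>0)"
    if i: "i < length Ps" and k: "k < length Ps" for i k
    unfolding chi2[OF i k] by (subst integral_eq_nn_integral) (auto simp: f_nonneg)
  have f2: "integrable P\<^sub>0 (\<lambda>x. (f i x)\<^sup>2)" if "i < length Ps" for i
    using ff[OF that that] by (simp add: power2_eq_square)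
  have f1: "integrable P\<^sub>0 (f i)" if "i < length Ps" for i
    using integrable_if_square_integrable[OF f_meas f2[OF that]] .
  have f_one: "(\<integral>x. f i x \<partial>P\<^sub>0) = 1" if i: "i < length Ps" for i
  proof -
    interpret Q: prob_space "Ps ! i" using i prob by simp
    show ?thesis using int[OF i, of "\<lambda>_. 1"] Q.prob_space by simp
  qed
  have X1: "integrable P\<^sub>0 X" using integrable_if_square_integrable[OF X X2] .
  interpret gram P\<^sub>0 "length Ps" "\<lambda>i x. f i x - 1" "\<lambda>x. X x - expectation X"
    "chi2_matrix P\<^sub>0 Ps" \<Delta>
  proof
    fix i assume i: "i < length Ps"
    show "integrable P\<^sub>0 (\<lambda>x. (f i x - 1)\<^sup>2)"
      using square_integrable_centered[OF f_meas f2[OF i]] .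
    have fX: "integrable P\<^sub>0 (\<lambda>x. f i x * X x)"
      using integrable_mult_square_integrable[OF f_meas X f2[OF i] X2] .
    have "(\<integral>x. (f i x - 1) * (X x - expectation X) \<partial>P\<^sub>0) =
        (\<integral>x. f i x * X x - expectation X * f i x - X x + expectation X \<partial>P\<^sub>0)"
      by (intro Bochner_Integration.integral_cong) (auto simp: algebra_simps)
    also have "\<dots> = (\<integral>x. f i x * X x \<partial>P\<^sub>0) - expectation X"
      using fX X1 f1[OF i] by (simp add: f_one[OF i] prob_space)
    finally show "\<Delta> $ i = (\<integral>x. (f i x - 1) * (X x - expectation X) \<partial>P\<^sub>0)"
      using i by (simp add: \<Delta>_entry int)
    fix j assume j: "j < length Ps"
    have "(\<integral>x. (f i x - 1) * (f j x - 1) \<partial>P\<^sub>0) = (\<integral>x. f i x * f j x - f i x - f j x + 1 \<partial>P\<^sub>0)"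
      by (intro Bochner_Integration.integral_cong) (auto simp: algebra_simps)
    also have "\<dots> = (\<integral>x. f i x * f j x \<partial>P\<^sub>0) - 1"
      using ff[OF i j] f1[OF i] f1[OF j] by (simp add: f_one i j prob_space)
    finally show "chi2_matrix P\<^sub>0 Ps $$ (i,j) = (\<integral>x. (f i x - 1) * (f j x - 1) \<partial>P\<^sub>0)"
      using i j by (simp add: chi2_matrix_def chi2')
  qed (use \<Delta> square_integrable_centered[OF X X2] in \<open>auto simp: chi2_matrix_def\<close>)
  show ?thesis using moore_penrose_bound X2 by (simp add: ext_variance_def)
qed

subsection \<open>The Hellinger affinity matrix\<close>

lemma hellinger_affinity_commute: "hellinger_affinity \<nu> p q = hellinger_affinity \<nu> q p"
  by (simp add: hellinger_affinity_def mult.commute)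

lemma
  assumes "is_density \<nu> P p" "prob_space P"
  shows density_sqrt_measurable: "(\<lambda>x. sqrt (p x)) \<in> borel_measurable \<nu>"
    and density_sqrt_integrable: "integrable \<nu> (\<lambda>x. (sqrt (p x))\<^sup>2)"
    and density_sqrt_integral: "(\<integral>x. (sqrt (p x))\<^sup>2 \<partial>\<nu>) = 1"
proof -
  have p [measurable]: "p \<in> borel_measurable \<nu>" and nn: "\<And>x. x \<in> space \<nu> \<Longrightarrow> 0 \<le> p x"
    and P: "P = density \<nu> (\<lambda>x. ennreal (p x))"
    using assms(1) by (auto simp: is_density_def)
  show "(\<lambda>x. sqrt (p x)) \<in> borel_measurable \<nu>" by simp
  interpret prob_space P by fact
  have "(\<integral>\<^sup>+x. ennreal (p x) \<partial>\<nu>) = emeasure P (space P)"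
    unfolding P by (simp add: emeasure_density nn_integral_set_ennreal cong: nn_integral_cong)
  then have 1: "(\<integral>\<^sup>+x. ennreal (p x) \<partial>\<nu>) = 1" by (simp add: emeasure_space_1)
  \<comment> \<open>Nonnegativity of \<open>p\<close> is known only on \<open>space \<nu>\<close>,
    so the square of the root is replaced by \<open>p\<close> under the integral and not
    pointwise.\<close>
  have cong: "integrable \<nu> (\<lambda>x. (sqrt (p x))\<^sup>2) = integrable \<nu> p"
    "(\<integral>x. (sqrt (p x))\<^sup>2 \<partial>\<nu>) = (\<integral>x. p x \<partial>\<nu>)"
    using nn by (auto intro!: Bochner_Integration.integrable_cong Bochner_Integration.integral_cong)
  show "integrable \<nu> (\<lambda>x. (sqrt (p x))\<^sup>2)"
    unfolding cong using 1 nn by (intro integrableI_nonneg) auto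
  show "(\<integral>x. (sqrt (p x))\<^sup>2 \<partial>\<nu>) = 1"
    unfolding cong using 1 nn by (subst integral_eq_nn_integral) auto
qed

lemma
  fixes Y :: "'a \<Rightarrow> real"
  assumes "is_density \<nu> P p" "Y \<in> borel_measurable \<nu>"
  shows density_integrable: "integrable P Y \<longleftrightarrow> integrable \<nu> (\<lambda>x. (sqrt (p x))\<^sup>2 * Y x)"
    and density_integral: "(\<integral>x. Y x \<partial>P) = (\<integral>x. (sqrt (p x))\<^sup>2 * Y x \<partial>\<nu>)"
proof -
  have p [measurable]: "p \<in> borel_measurable \<nu>" and nn: "\<And>x. x \<in> space \<nu> \<Longrightarrow> 0 \<le> p x"
    and P: "P = density \<nu> (\<lambda>x. ennreal (p x))"
    using assms(1) by (auto simp: is_density_def)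
  show "integrable P Y \<longleftrightarrow> integrable \<nu> (\<lambda>x. (sqrt (p x))\<^sup>2 * Y x)"
    unfolding P using nn assms(2)
    by (subst integrable_density) (auto intro!: Bochner_Integration.integrable_cong)
  show "(\<integral>x. Y x \<partial>P) = (\<integral>x. (sqrt (p x))\<^sup>2 * Y x \<partial>\<nu>)"
    unfolding P using nn assms(2)
    by (subst integral_density) (auto intro!: Bochner_Integration.integral_cong)
qed

lemma sqrt_density_mult_integrable:
  assumes "is_density \<nu> P p" "prob_space P" "is_density \<nu> Q q" "prob_space Q"
  shows "integrable \<nu> (\<lambda>x. sqrt (p x) * sqrt (q x))"
  using assms by (intro integrable_mult_square_integrable density_sqrt_measurable
      density_sqrt_integrable)

lemma hellinger_affinity_eq:
  "hellinger_affinity \<nu> p q = (\<integral>x. sqrt (p x) * sqrt (q x) \<partial>\<nu>)"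
  by (simp add: hellinger_affinity_def real_sqrt_mult)

lemma hellinger_affinity_self:
  assumes "is_density \<nu> P p" "prob_space P"
  shows "hellinger_affinity \<nu> p p = 1"
  using density_sqrt_integral[OF assms] by (simp add: hellinger_affinity_eq power2_eq_square)

text \<open>The squared Hellinger distance is \<open>2 - 2 \<rho>(P, Q)\<close>.\<close>

lemma hellinger_affinity_ge_1_imp_eq:
  assumes p: "is_density \<nu> P p" "prob_space P" and q: "is_density \<nu> Q q" "prob_space Q"
    and ge: "hellinger_affinity \<nu> p q \<ge> 1"
  shows "P = Q"
proof -
  note [measurable] = density_sqrt_measurable[OF p] density_sqrt_measurable[OF q]
  note int = density_sqrt_integrable[OF p] density_sqrt_integrable[OF q]
    sqrt_density_mult_integrable[OF p q]
  let ?d = "\<lambda>x. (sqrt (p x))\<^sup>2 + (sqrt (q x))\<^sup>2 - 2 * (sqrt (p x) * sqrt (q x))"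
  have d: "?d x = (sqrt (p x) - sqrt (q x))\<^sup>2" for x by (simp add: power2_eq_square algebra_simps)
  have "(\<integral>x. ?d x \<partial>\<nu>) = 2 - 2 * hellinger_affinity \<nu> p q"
    using int by (simp add: hellinger_affinity_eq density_sqrt_integral[OF p] density_sqrt_integral[OF q])
  moreover have "(\<integral>x. ?d x \<partial>\<nu>) \<ge> 0" unfolding d by simp
  ultimately have "(\<integral>x. ?d x \<partial>\<nu>) = 0" using ge by linarith
  moreover have "integrable \<nu> ?d" using int by simp
  ultimately have "AE x in \<nu>. ?d x = 0"
    by (subst integral_nonneg_eq_0_iff_AE[symmetric]) (simp_all add: d)
  then have "AE x in \<nu>. ennreal (p x) = ennreal (q x)"
    by eventually_elim (simp add: d)
  then show ?thesis using p(1) q(1) by (auto simp: is_density_def intro!: density_cong)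
qed

section \<open>Inner products that represent mean differences\<close>

text \<open>The number w_lj, with \<open>p\<close> in the role of p_l, \<open>q\<close> in that of
  p_j and \<open>c\<close> standing for the mean of \<open>X\<close> under \<open>P\<close>.\<close>

definition hellinger_coefficient ::
  "'a measure \<Rightarrow> ('a \<Rightarrow> real) \<Rightarrow> ('a \<Rightarrow> real) \<Rightarrow> ('a \<Rightarrow> real) \<Rightarrow> real \<Rightarrow> real" where
  "hellinger_coefficient \<nu> p q X c =
     (\<integral>x. (sqrt (q x) / hellinger_affinity \<nu> q p - sqrt (p x)) * ((X x - c) * sqrt (p x)) \<partial>\<nu>)"

text \<open>This supplies the vector h of the Gram estimate. When \<open>c\<close> is the mean under
  \<open>P\<close>, its squared norm is the variance.\<close>

lemma centered_sqrt_density: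
  assumes p: "is_density \<nu> P p" "prob_space P" and X: "X \<in> borel_measurable \<nu>"
    and X2: "integrable P (\<lambda>x. (X x)\<^sup>2)"
  shows "(\<lambda>x. (X x - c) * sqrt (p x)) \<in> borel_measurable \<nu>"
    and "integrable \<nu> (\<lambda>x. ((X x - c) * sqrt (p x))\<^sup>2)"
    and "(\<integral>x. ((X x - c) * sqrt (p x))\<^sup>2 \<partial>\<nu>) = (\<integral>x. (X x - c)\<^sup>2 \<partial>P)"
proof -
  note [measurable] = density_sqrt_measurable[OF p] X
  interpret prob_space P by fact
  have "X \<in> borel_measurable P" using X p(1) by (simp add: is_density_def)
  show "(\<lambda>x. (X x - c) * sqrt (p x)) \<in> borel_measurable \<nu>" by measurable
  from square_integrable_centered[OF \<open>X \<in> borel_measurable P\<close> X2]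
  have "integrable P (\<lambda>x. (X x - c)\<^sup>2)" .
  then show "integrable \<nu> (\<lambda>x. ((X x - c) * sqrt (p x))\<^sup>2)"
    by (subst (asm) density_integrable[OF p(1)]) (simp_all add: power_mult_distrib mult.commute)
  show "(\<integral>x. ((X x - c) * sqrt (p x))\<^sup>2 \<partial>\<nu>) = (\<integral>x. (X x - c)\<^sup>2 \<partial>P)"
    by (subst density_integral[OF p(1)]) (simp_all add: power_mult_distrib mult.commute)
qed

text \<open>The part of the coefficient with sqrt p twice integrates X - c against \<open>P\<close>
  and vanishes because \<open>c\<close> is the mean.\<close>

lemma hellinger_coefficient_eq:
  assumes p: "is_density \<nu> P p" "prob_space P" and q: "is_density \<nu> Q q" "prob_space Q"
    and X: "X \<in> borel_measurable \<nu>" and X2: "integrable P (\<lambda>x. (X x)\<^sup>2)"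
    and c: "c = (\<integral>x. X x \<partial>P)"
  shows "integrable \<nu> (\<lambda>x. (X x - c) * sqrt (p x) * sqrt (q x))" (is ?int)
    and "hellinger_coefficient \<nu> p q X c =
      (\<integral>x. (X x - c) * sqrt (p x) * sqrt (q x) \<partial>\<nu>) / hellinger_affinity \<nu> q p"
proof -
  interpret prob_space P by fact
  note h = centered_sqrt_density[OF p X X2, of c]
  show ?int
    by (rule integrable_mult_square_integrable[OF h(1) density_sqrt_measurable[OF q] h(2)
          density_sqrt_integrable[OF q]])
  moreover have "integrable \<nu> (\<lambda>x. (X x - c) * sqrt (p x) * sqrt (p x))"
    by (rule integrable_mult_square_integrable[OF h(1) density_sqrt_measurable[OF p] h(2)
          density_sqrt_integrable[OF p]])
  moreover have "(\<integral>x. (X x - c) * sqrt (p x) * sqrt (p x) \<partial>\<nu>) = 0"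
  proof -
    have XP: "X \<in> borel_measurable P" using X p(1) by (simp add: is_density_def)
    have "(\<integral>x. (X x - c) * sqrt (p x) * sqrt (p x) \<partial>\<nu>) = (\<integral>x. X x - c \<partial>P)"
      using X by (subst density_integral[OF p(1)]) (simp_all add: power2_eq_square mult_ac del: real_sqrt_mult_self)
    also have "\<dots> = 0"
      using integrable_if_square_integrable[OF XP X2] by (simp add: c prob_space)
    finally show ?thesis .
  qed
  moreover have "hellinger_coefficient \<nu> p q X c =
      (\<integral>x. (X x - c) * sqrt (p x) * sqrt (q x) / hellinger_affinity \<nu> q p -
        (X x - c) * sqrt (p x) * sqrt (p x) \<partial>\<nu>)"
    unfolding hellinger_coefficient_def
    by (intro Bochner_Integration.integral_cong) (simp_all add: algebra_simps diff_divide_distrib del: real_sqrt_mult_self)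
  ultimately show "hellinger_coefficient \<nu> p q X c =
      (\<integral>x. (X x - c) * sqrt (p x) * sqrt (q x) \<partial>\<nu>) / hellinger_affinity \<nu> q p"
    by simp
qed

text \<open>Both coefficients have the same denominator, the affinity. In the difference of their
  numerators X cancels, since (X - a) - (X - b) = b - a, and what remains is b - a times the
  affinity.\<close>

lemma expectation_diff_hellinger:
  assumes p: "is_density \<nu> P p" "prob_space P" and q: "is_density \<nu> Q q" "prob_space Q"
    and X: "X \<in> borel_measurable \<nu>"
    and X2: "integrable P (\<lambda>x. (X x)\<^sup>2)" "integrable Q (\<lambda>x. (X x)\<^sup>2)"
    and pos: "hellinger_affinity \<nu> p q > 0"
    and a: "a = (\<integral>x. X x \<partial>P)" and b: "b = (\<integral>x. X x \<partial>Q)"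
  shows "b - a = hellinger_coefficient \<nu> p q X a - hellinger_coefficient \<nu> q p X b"
proof -
  let ?r = "hellinger_affinity \<nu> p q"
  note P = hellinger_coefficient_eq[OF p q X X2(1) a]
  note Q = hellinger_coefficient_eq[OF q p X X2(2) b]
  have "(\<integral>x. (X x - a) * sqrt (p x) * sqrt (q x) \<partial>\<nu>) - (\<integral>x. (X x - b) * sqrt (q x) * sqrt (p x) \<partial>\<nu>)
      = (\<integral>x. (X x - a) * sqrt (p x) * sqrt (q x) - (X x - b) * sqrt (q x) * sqrt (p x) \<partial>\<nu>)"
    using P(1) Q(1) by simp
  also have "\<dots> = (\<integral>x. (b - a) * (sqrt (p x) * sqrt (q x)) \<partial>\<nu>)"
    by (intro Bochner_Integration.integral_cong) (simp_all add: algebra_simps)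
  also have "\<dots> = (b - a) * ?r" by (simp add: hellinger_affinity_eq)
  finally show ?thesis
    unfolding P(2) Q(2) hellinger_affinity_commute[of \<nu> q p] using pos
    by (simp add: diff_divide_distrib[symmetric])
qed

lemma hellinger_gram:
  assumes p: "is_density \<nu> P p" "prob_space P"
    and qs: "\<And>q. q \<in> set qs \<Longrightarrow> \<exists>Q. is_density \<nu> Q q \<and> prob_space Q"
    and pos: "\<And>q. q \<in> set qs \<Longrightarrow> hellinger_affinity \<nu> q p > 0"
    and h: "h \<in> borel_measurable \<nu>" "integrable \<nu> (\<lambda>x. (h x)\<^sup>2)"
  shows "gram \<nu> (length qs) (\<lambda>i x. sqrt ((qs ! i) x) / hellinger_affinity \<nu> (qs ! i) p - sqrt (p x))
    h (hellinger_matrix \<nu> p qs)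
    (vec (length qs) (\<lambda>i. \<integral>x. (sqrt ((qs ! i) x) / hellinger_affinity \<nu> (qs ! i) p - sqrt (p x)) *
      h x \<partial>\<nu>))"
proof
  note pm [measurable] = density_sqrt_measurable[OF p]
  fix i assume i: "i < length qs"
  then obtain Q where Q: "is_density \<nu> Q (qs ! i)" "prob_space Q" using qs[of "qs ! i"] by auto
  let ?r = "hellinger_affinity \<nu> (qs ! i) p"
  note qm [measurable] = density_sqrt_measurable[OF Q]
  show "(\<lambda>x. sqrt ((qs ! i) x) / ?r - sqrt (p x)) \<in> borel_measurable \<nu>" by measurable
  have sq: "(a / r - b)\<^sup>2 = a\<^sup>2 / r\<^sup>2 - 2 / r * (a * b) + b\<^sup>2" for a b r :: real
    by (simp add: power2_diff power_divide)
  show "integrable \<nu> (\<lambda>x. (sqrt ((qs ! i) x) / ?r - sqrt (p x))\<^sup>2)"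
    unfolding sq
    using density_sqrt_integrable[OF p] density_sqrt_integrable[OF Q]
      sqrt_density_mult_integrable[OF Q p]
    by (intro Bochner_Integration.integrable_add Bochner_Integration.integrable_diff
        integrable_divide integrable_mult_right) auto
  fix j assume j: "j < length qs"
  then obtain R where R: "is_density \<nu> R (qs ! j)" "prob_space R" using qs[of "qs ! j"] by auto
  let ?s = "hellinger_affinity \<nu> (qs ! j) p"
  have r: "?r > 0" "?s > 0" using pos i j by auto
  have "(\<integral>x. (sqrt ((qs ! i) x) / ?r - sqrt (p x)) * (sqrt ((qs ! j) x) / ?s - sqrt (p x)) \<partial>\<nu>)
    = (\<integral>x. sqrt ((qs ! i) x) * sqrt ((qs ! j) x) / (?r * ?s) - sqrt ((qs ! i) x) * sqrt (p x) / ?r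
       - sqrt ((qs ! j) x) * sqrt (p x) / ?s + (sqrt (p x))\<^sup>2 \<partial>\<nu>)"
    by (intro Bochner_Integration.integral_cong)
      (simp_all add: left_diff_distrib right_diff_distrib power2_eq_square mult.commute)
  \<comment> \<open>The two mixed terms contribute -1 each and the square of sqrt p contributes +1,
    which leaves the -1 of the matrix entry.\<close>
  also have "\<dots> = hellinger_affinity \<nu> (qs ! i) (qs ! j) / (?r * ?s) - ?r / ?r - ?s / ?s + 1"
    using sqrt_density_mult_integrable[OF Q R] sqrt_density_mult_integrable[OF Q p]
      sqrt_density_mult_integrable[OF R p] density_sqrt_integrable[OF p]
    unfolding hellinger_affinity_eq[of \<nu> "qs ! i"] hellinger_affinity_eq[of \<nu> "qs ! j"]
      density_sqrt_integral[OF p, symmetric]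
    by (simp del: real_sqrt_pow2_iff)
  finally show "hellinger_matrix \<nu> p qs $$ (i, j) =
      (\<integral>x. (sqrt ((qs ! i) x) / ?r - sqrt (p x)) * (sqrt ((qs ! j) x) / ?s - sqrt (p x)) \<partial>\<nu>)"
    using r i j by (simp add: hellinger_matrix_def)
qed (use h in \<open>auto simp: hellinger_matrix_def\<close>)

section \<open>Summation over all pairs of measures\<close>

text \<open>With S the sum of the a_j, T the sum of their squares and N the number of indices, both
  sides equal 2 N T - 2 S^2.\<close>

lemma sum_pairwise_square_diff:
  fixes a :: "'i \<Rightarrow> real"
  assumes "finite I" "I \<noteq> {}"
  shows "2 * real (card I) * (\<Sum>j\<in>I. (a j - 1 / real (card I) * (\<Sum>l\<in>I. a l))\<^sup>2)
    = (\<Sum>j\<in>I. \<Sum>k\<in>I. (a j - a k)\<^sup>2)"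
proof -
  define N S T where "N = real (card I)" and "S = (\<Sum>l\<in>I. a l)" and "T = (\<Sum>l\<in>I. (a l)\<^sup>2)"
  have N: "N \<noteq> 0" using assms by (simp add: N_def)
  have "(\<Sum>j\<in>I. \<Sum>k\<in>I. (a j - a k)\<^sup>2) = (\<Sum>j\<in>I. N * (a j)\<^sup>2 + T - 2 * a j * S)"
    unfolding power2_diff
    by (simp add: sum.distrib sum_subtractf N_def S_def T_def sum_distrib_left mult.assoc)
  also have "\<dots> = 2 * N * T - 2 * S * S"
    by (simp add: sum.distrib sum_subtractf sum_distrib_left[symmetric] sum_distrib_right[symmetric]
        S_def[symmetric] T_def[symmetric] N_def[symmetric])
  finally have 1: "(\<Sum>j\<in>I. \<Sum>k\<in>I. (a j - a k)\<^sup>2) = 2 * N * T - 2 * S * S" .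
  have "(\<Sum>j\<in>I. (a j - 1 / N * S)\<^sup>2) = (\<Sum>j\<in>I. (a j)\<^sup>2 + (S / N)\<^sup>2 - 2 * (S / N) * a j)"
    by (simp add: power2_diff mult_ac)
  also have "\<dots> = T + N * (S / N)\<^sup>2 - 2 * (S / N) * S"
  proof -
    have "(\<Sum>j\<in>I. 2 * (S / N) * a j) = 2 * (S / N) * S"
      by (simp only: sum_distrib_left[symmetric] S_def)
    then show ?thesis by (simp add: sum.distrib sum_subtractf T_def N_def)
  qed
  also have "2 * N * \<dots> = 2 * N * T - 2 * S * S"
    using N by (simp add: field_simps power2_eq_square)
  finally show ?thesis unfolding 1 N_def S_def .
qed

text \<open>If all variances are finite, the Gram bound for each centre l controls the sum of the
  squared coefficients w_lj by \<Lambda> V_l, and these bounds are added. An infinite variance needs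
  its own argument, because \<open>0 * \<infinity>\<close> is 0 in \<open>ereal\<close>.\<close>

lemma hellinger_lower_bound:
  fixes X :: "'a \<Rightarrow> real" and P :: "nat \<Rightarrow> 'a measure"
  assumes M: "M \<ge> 2"
    and P: "\<And>j. j \<in> {1..M} \<Longrightarrow> is_density \<nu> (P j) (p j)" "\<And>j. j \<in> {1..M} \<Longrightarrow> prob_space (P j)"
    and X: "X \<in> borel_measurable \<nu>"
    and pos: "\<And>j k. j \<in> {1..M} \<Longrightarrow> k \<in> {1..M} \<Longrightarrow> hellinger_affinity \<nu> (p j) (p k) > 0"
    and E: "\<And>j. E j = (\<integral>x. X x \<partial>(P j))"
    and A: "A = (\<lambda>l. hellinger_matrix \<nu> (p l) (map p (filter (\<lambda>j. j \<noteq> l) [1..<Suc M])))"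
  shows "ereal (\<Sum>j=1..M. \<Sum>k=1..M. (E j - E k)\<^sup>2)
    \<le> ereal (4 * Max ((\<lambda>l. largest_eigenvalue (A l)) ` {1..M})) * (\<Sum>k=1..M. ext_variance (P k) X)"
proof -
  define \<Lambda> where "\<Lambda> = Max ((\<lambda>l. largest_eigenvalue (A l)) ` {1..M})"
  define js where "js l = filter (\<lambda>j. j \<noteq> l) [1..<Suc M]" for l
  have js: "set (js l) = {1..M} - {l}" "distinct (js l)" for l
    by (auto simp: js_def)
  \<comment> \<open>M \<ge> 2 guarantees an index other than \<open>l\<close>, so \<open>A l\<close>
    has positive size, as the eigenvalue bounds require.\<close>
  have js_ne: "length (js l) > 0" for l
  proof -
    have "(if l = 1 then 2 else 1) \<in> set (js l)" using M unfolding js by auto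
    then show ?thesis by (auto simp: length_pos_if_in_set)
  qed
  have A_js: "A l = hellinger_matrix \<nu> (p l) (map p (js l))" for l
    by (simp add: A js_def)
  have gram: "gram \<nu> (length (map p (js l)))
      (\<lambda>i x. sqrt ((map p (js l) ! i) x) / hellinger_affinity \<nu> (map p (js l) ! i) (p l) - sqrt (p l x))
      h (A l) (vec (length (map p (js l))) (\<lambda>i. \<integral>x. (sqrt ((map p (js l) ! i) x) /
        hellinger_affinity \<nu> (map p (js l) ! i) (p l) - sqrt (p l x)) * h x \<partial>\<nu>))"
    if "l \<in> {1..M}" "h \<in> borel_measurable \<nu>" "integrable \<nu> (\<lambda>x. (h x)\<^sup>2)" for l h
  proof -
    have "\<exists>Q. is_density \<nu> Q (p j) \<and> prob_space Q" if "j \<in> {1..M}" for j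
      using P[OF that] by blast
    then show ?thesis
      unfolding A_js using that P pos js(1)[of l]
      by (intro hellinger_gram[where P = "P l"]) auto
  qed
  have eig_le: "largest_eigenvalue (A l) \<le> \<Lambda>" if "l \<in> {1..M}" for l
    using that by (simp add: \<Lambda>_def)
  \<comment> \<open>Only the Gram structure of \<open>A l\<close> matters here, so h = 0
    serves.\<close>
  have eig_nonneg: "largest_eigenvalue (A l) \<ge> 0" if "l \<in> {1..M}" for l
    using gram.largest_eigenvalue_nonneg[OF gram[OF that, of "\<lambda>_. 0"]] js_ne[of l] by simp
  have \<Lambda>_nonneg: "\<Lambda> \<ge> 0" using eig_le[of 1] eig_nonneg[of 1] M by simp
  show ?thesis
  proof (cases "\<forall>k\<in>{1..M}. integrable (P k) (\<lambda>x. (X x)\<^sup>2)")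
    case True
    define V where "V k = (\<integral>x. (X x - E k)\<^sup>2 \<partial>(P k))" for k
    define w where "w k j = hellinger_coefficient \<nu> (p k) (p j) X (E k)" for k j
    have V_nonneg: "V k \<ge> 0" for k by (simp add: V_def)
    have ext: "ext_variance (P k) X = ereal (V k)" if "k \<in> {1..M}" for k
      using True that by (simp add: ext_variance_def V_def E)
    have w_self: "w l l = 0" if "l \<in> {1..M}" for l
      by (simp add: w_def hellinger_coefficient_def hellinger_affinity_self[OF P[OF that]])
    have bound: "(\<Sum>j=1..M. (w l j)\<^sup>2) \<le> \<Lambda> * V l" if l: "l \<in> {1..M}" for l
    proof -
      let ?h = "\<lambda>x. (X x - E l) * sqrt (p l x)"
      note h = centered_sqrt_density[OF P[OF l] X True[rule_format, OF l], of "E l"]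
      let ?w = "vec (length (js l)) (\<lambda>i. w l (js l ! i))"
      \<comment> \<open>The term j = l is zero because a density has affinity 1 with itself. The
        other terms are listed along \<open>js l\<close>, the order of the rows of
        \<open>A l\<close>.\<close>
      have "(\<Sum>j=1..M. (w l j)\<^sup>2) = (\<Sum>j\<in>{1..M} - {l}. (w l j)\<^sup>2)"
        using sum.remove[OF finite_atLeastAtMost l, of "\<lambda>j. (w l j)\<^sup>2"] w_self[OF l] by simp
      also have "\<dots> = (\<Sum>i<length (js l). (w l (js l ! i))\<^sup>2)"
        by (rule sum.reindex_bij_betw[OF bij_betw_nth[OF js(2) refl js(1)[symmetric]], symmetric])
      also have "\<dots> = ?w \<bullet> ?w"
        by (simp add: scalar_prod_def lessThan_atLeast0 power2_eq_square)
      also have "?w = vec (length (map p (js l))) (\<lambda>i. \<integral>x. (sqrt ((map p (js l) ! i) x) /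
          hellinger_affinity \<nu> (map p (js l) ! i) (p l) - sqrt (p l x)) * ?h x \<partial>\<nu>)"
        by (intro eq_vecI) (simp_all add: w_def hellinger_coefficient_def)
      also have "\<dots> \<bullet> \<dots> \<le> largest_eigenvalue (A l) * (\<integral>x. (?h x)\<^sup>2 \<partial>\<nu>)"
        using gram.largest_eigenvalue_bound[OF gram[OF l h(1,2)]] js_ne[of l] by simp
      also have "\<dots> \<le> \<Lambda> * V l"
        unfolding h(3) V_def using eig_le[OF l] by (intro mult_right_mono) simp_all
      finally show ?thesis .
    qed
    have "(\<Sum>j=1..M. \<Sum>k=1..M. (E j - E k)\<^sup>2)
        \<le> (\<Sum>j=1..M. \<Sum>k=1..M. 2 * (w k j)\<^sup>2 + 2 * (w j k)\<^sup>2)"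
    proof (intro sum_mono)
      fix j k assume j: "j \<in> {1..M}" and k: "k \<in> {1..M}"
      have "E j - E k = w k j - w j k"
        unfolding w_def
        by (rule expectation_diff_hellinger[OF P[OF k] P[OF j] X True[rule_format, OF k]
              True[rule_format, OF j] pos[OF k j] E E])
      moreover have "(a - b)\<^sup>2 \<le> 2 * a\<^sup>2 + 2 * b\<^sup>2" for a b :: real
        using zero_le_power2[of "a + b"] by (simp add: power2_eq_square algebra_simps)
      ultimately show "(E j - E k)\<^sup>2 \<le> 2 * (w k j)\<^sup>2 + 2 * (w j k)\<^sup>2" by simp
    qed
    \<comment> \<open>Exchanging the order of summation makes the two halves equal, so the factors 2
      add up to 4.\<close>
    also have "\<dots> = 4 * (\<Sum>l=1..M. \<Sum>j=1..M. (w l j)\<^sup>2)"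
      using sum.swap[of "\<lambda>j k. (w k j)\<^sup>2" "{1..M}" "{1..M}"]
      by (simp add: sum.distrib sum_distrib_left[symmetric])
    also have "\<dots> \<le> 4 * (\<Sum>l=1..M. \<Lambda> * V l)"
      using bound by (intro mult_left_mono sum_mono) auto
    also have "\<dots> = 4 * \<Lambda> * (\<Sum>l=1..M. V l)" by (simp add: sum_distrib_left mult.assoc)
    finally show ?thesis using ext by (simp add: \<Lambda>_def)
  next
    case False
    then obtain m where m: "m \<in> {1..M}" "ext_variance (P m) X = \<infinity>"
      by (auto simp: ext_variance_def)
    have "ext_variance (P k) X \<ge> 0" for k by (simp add: ext_variance_def)
    then have inf: "(\<Sum>k=1..M. ext_variance (P k) X) = \<infinity>"
      using m sum_Pinfty[of "\<lambda>k. ext_variance (P k) X" "{1..M}"] by auto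
    show ?thesis
    proof (cases "\<Lambda> > 0")
      case True
      then show ?thesis using inf by (simp add: \<Lambda>_def)
    next
      case False
      then have "\<Lambda> = 0" using \<Lambda>_nonneg by simp
      \<comment> \<open>Here the right-hand side is \<open>0 * \<infinity> = 0\<close>; all affinities equal 1 and hence all \<open>P j\<close> coincide.\<close>
      have P_eq: "P j = P l" if j: "j \<in> {1..M}" and l: "l \<in> {1..M}" and "j \<noteq> l" for j l
      proof -
        let ?r = "hellinger_affinity \<nu> (p j) (p l)"
        obtain i where i: "i < length (js l)" "js l ! i = j"
          using j \<open>j \<noteq> l\<close> js(1)[of l] in_set_conv_nth[of j "js l"] by blast
        interpret gram \<nu> "length (map p (js l))"
          "\<lambda>i x. sqrt ((map p (js l) ! i) x) / hellinger_affinity \<nu> (map p (js l) ! i) (p l) - sqrt (p l x)"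
          "\<lambda>_. 0" "A l" "vec (length (map p (js l))) (\<lambda>i. \<integral>x. (sqrt ((map p (js l) ! i) x) /
            hellinger_affinity \<nu> (map p (js l) ! i) (p l) - sqrt (p l x)) * 0 \<partial>\<nu>)"
          by (rule gram[OF l]) auto
        \<comment> \<open>The diagonal entry 1 / r^2 - 1 is at most the largest eigenvalue, hence at
          most \<Lambda> = 0. So r \<ge> 1, the equality case of the affinity.\<close>
        have "A l $$ (i,i) \<le> 0"
          using diagonal_le_largest_eigenvalue[OF G symmetric, of i] eig_le[OF l] \<open>\<Lambda> = 0\<close> i by simp
        moreover have "A l $$ (i,i) = 1 / (?r * ?r) - 1"
          using i by (simp add: A_js hellinger_matrix_def hellinger_affinity_self[OF P[OF j]])
        ultimately have "?r * ?r \<ge> 1" using pos[OF j l] by (simp add: divide_le_eq split: if_splits)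
        then have "?r \<ge> 1" using pos[OF j l] mult_strict_mono[of ?r 1 ?r 1] by force
        then show ?thesis using hellinger_affinity_ge_1_imp_eq P j l by blast
      qed
      have "(E j - E k)\<^sup>2 = 0" if "j \<in> {1..M}" "k \<in> {1..M}" for j k
        using P_eq[OF that] unfolding E by (cases "j = k") simp_all
      then have "(\<Sum>j=1..M. \<Sum>k=1..M. (E j - E k)\<^sup>2) = 0" by (intro sum.neutral ballI)
      then show ?thesis using \<open>\<Lambda> = 0\<close> by (simp add: \<Lambda>_def flip: zero_ereal_def)
    qed
  qed
qed

theorem theorem2p2:
  fixes M :: nat and S :: "'a measure" and P :: "nat \<Rightarrow> 'a measure" and X :: "'a \<Rightarrow> real"
    and E :: "nat \<Rightarrow> real"
  assumes "M \<ge> 1"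
    and "\<And>j. j \<le> M \<Longrightarrow> prob_space (P j)"
    and "\<And>j. j \<le> M \<Longrightarrow> sets (P j) = sets S"
    and "X \<in> borel_measurable S"
    and E_def: "\<And>j. E j = prob_space.expectation (P j) X"
  shows
    "((\<forall>j\<in>{1..M}. absolutely_continuous (P 0) (P j)) \<and>
      (\<forall>j\<in>{1..M}. \<forall>k\<in>{1..M}. chi2_integral (P 0) (P j) (P k) < \<infinity>) \<longrightarrow>
        (let \<Delta> = vec_of_list (map (\<lambda>j. E j - E 0) [1..<Suc M]);
             C = chi2_matrix (P 0) (map P [1..<Suc M])
         in ereal (scalar_prod \<Delta> (moore_penrose C *\<^sub>v \<Delta>)) \<le> ext_variance (P 0) X))
     \<and>
     (\<forall>\<nu> p. M \<ge> 2 \<and> (\<forall>j\<in>{1..M}. is_density \<nu> (P j) (p j)) \<and>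
        (\<forall>j\<in>{1..M}. \<forall>k\<in>{1..M}. hellinger_affinity \<nu> (p j) (p k) > 0) \<longrightarrow>
        (let A = (\<lambda>l. hellinger_matrix \<nu> (p l) (map p (filter (\<lambda>j. j \<noteq> l) [1..<Suc M])))
         in 2 * real M * (\<Sum>j=1..M. (E j - 1 / real M * (\<Sum>l=1..M. E l))^2)
              = (\<Sum>j=1..M. \<Sum>k=1..M. (E j - E k)^2) \<and>
            ereal (\<Sum>j=1..M. \<Sum>k=1..M. (E j - E k)^2)
              \<le> ereal (4 * Max ((\<lambda>l. largest_eigenvalue (A l)) ` {1..M}))
                  * (\<Sum>k=1..M. ext_variance (P k) X)))"
proof (intro conjI impI allI)
  assume *: "(\<forall>j\<in>{1..M}. absolutely_continuous (P 0) (P j)) \<and>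
      (\<forall>j\<in>{1..M}. \<forall>k\<in>{1..M}. chi2_integral (P 0) (P j) (P k) < \<infinity>)"
  have "X \<in> borel_measurable (P 0)"
    using assms(3)[of 0] assms(4) by (simp cong: measurable_cong_sets)
  \<comment> \<open>Position i of the lists over \<open>[1..<Suc M]\<close> carries the index
    \<open>Suc i\<close>, matching the 0-based entries of \<Delta> and of the matrix.\<close>
  with * assms(2,3) show "let \<Delta> = vec_of_list (map (\<lambda>j. E j - E 0) [1..<Suc M]);
      C = chi2_matrix (P 0) (map P [1..<Suc M])
    in ereal (scalar_prod \<Delta> (moore_penrose C *\<^sub>v \<Delta>)) \<le> ext_variance (P 0) X"
    unfolding Let_def
    by (intro chi2_lower_bound) (auto simp: E_def less_Suc_eq_le vec_of_list_index carrier_dim_vec simp del: upt_Suc)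
next
  fix \<nu> p
  assume *: "M \<ge> 2 \<and> (\<forall>j\<in>{1..M}. is_density \<nu> (P j) (p j)) \<and>
        (\<forall>j\<in>{1..M}. \<forall>k\<in>{1..M}. hellinger_affinity \<nu> (p j) (p k) > 0)"
  let ?A = "\<lambda>l. hellinger_matrix \<nu> (p l) (map p (filter (\<lambda>j. j \<noteq> l) [1..<Suc M]))"
  \<comment> \<open>\<open>P 1\<close> has a density with respect to \<nu> and so shares its
    \<sigma>-algebra; index 1 is available because M \<ge> 1.\<close>
  have "sets S = sets \<nu>"
    using * assms(1) assms(3)[of 1] by (auto simp: is_density_def)
  then have "X \<in> borel_measurable \<nu>"
    using assms(4) by (simp cong: measurable_cong_sets)
  then have "ereal (\<Sum>j=1..M. \<Sum>k=1..M. (E j - E k)^2)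
      \<le> ereal (4 * Max ((\<lambda>l. largest_eigenvalue (?A l)) ` {1..M}))
          * (\<Sum>k=1..M. ext_variance (P k) X)"
    using * assms(2) E_def by (intro hellinger_lower_bound[where p = p and \<nu> = \<nu>]) auto
  moreover have "2 * real M * (\<Sum>j=1..M. (E j - 1 / real M * (\<Sum>l=1..M. E l))^2)
      = (\<Sum>j=1..M. \<Sum>k=1..M. (E j - E k)^2)"
    using sum_pairwise_square_diff[of "{1..M}" E] assms(1) by simp
  ultimately show "let A = ?A
    in 2 * real M * (\<Sum>j=1..M. (E j - 1 / real M * (\<Sum>l=1..M. E l))^2)
          = (\<Sum>j=1..M. \<Sum>k=1..M. (E j - E k)^2) \<and>
        ereal (\<Sum>j=1..M. \<Sum>k=1..M. (E j - E k)^2)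
          \<le> ereal (4 * Max ((\<lambda>l. largest_eigenvalue (A l)) ` {1..M}))
              * (\<Sum>k=1..M. ext_variance (P k) X)"
    unfolding Let_def by blast
qed

end
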